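(* Let $k$ be an algebraically closed field, and let $r$ and $e$ be positive integers with $e$ even. If all artinian compressed Gorenstein $k$-algebras of codimension $\le r$ and socle degree $e-1$ have the Weak Lefschetz Property, then all artinian Gorenstein $k$-algebras of codimension $\le r$ and socle degree $e$ have the Weak Lefschetz Property. In particular, if all codimension $3$ artinian compressed Gorenstein $k$-algebras of odd socle degree have the Weak Lefschetz Property, then all codimension $3$ artinian Gorenstein $k$-algebras have the Weak Lefschetz Property.
   Context: All algebras are standard graded: $A=S/I$ with $S=k[x_1,\dots,x_n]$ a polynomial ring with the standard grading and $I$ a homogeneous ideal. $A$ is artinian if it is finite-dimensional over $k$. Its $h$-vector is $(h_0,h_1,\dots,h_e)$ with $h_i=\dim_k [A]_i$, where $e$, the socle degree, is the last index with $[A]_e\neq 0$. The codimension of $A$ is $h_1$. $A$ is Gorenstein if its socle $\{a\in A: a\cdot(x_1,\dots,x_n)=0\}$ is one-dimensional over $k$. An artinian Gorenstein algebra of codimension $c$ and socle degree $e$ is compressed if $h_i=\min\{\dim_k S_i,\dim_k S_{e-i}\}$ for all $0\le i\le e$, where $S$ is the polynomial ring in $c$ variables over $k$. An artinian algebra $A$ has the Weak Lefschetz Property if there is a linear form $L\in[A]_1$ such that for every $i\ge 0$ the multiplication map $\times L:[A]_i\to[A]_{i+1}$ is injective or surjective. *)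

theory Defs
  imports
    "HOL-Algebra.QuotRing"
    "HOL-Algebra.Embedded_Algebras"
    "HOL-Computational_Algebra.Polynomial"
    "HOL-Library.Poly_Mapping"
begin

text \<open>
  Polynomials in countably many variables $x_0, x_1, \ldots$ over $k$, as finitely supported
  functions from monomials (finitely supported exponent functions) to coefficients. The
  polynomial ring in \<open>n\<close> variables is the subring of those involving only
  $x_0, \ldots, x_{n-1}$.
\<close>

type_synonym 'k mpol = "(nat \<Rightarrow>\<^sub>0 nat) \<Rightarrow>\<^sub>0 'k"

definition mpol_ring :: "nat \<Rightarrow> 'k::field mpol ring" where
  "mpol_ring n =
    \<lparr>carrier = {p. \<forall>m \<in> Poly_Mapping.keys p. Poly_Mapping.keys m \<subseteq> {..<n}},
     monoid.mult = (*), one = 1, zero = 0, add = (+)\<rparr>"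

definition mpol_const :: "'k::field \<Rightarrow> 'k mpol" where
  "mpol_const c = Poly_Mapping.single 0 c"

definition mpol_var :: "nat \<Rightarrow> 'k::field mpol" where
  "mpol_var j = Poly_Mapping.single (Poly_Mapping.single j 1) 1"

definition monom_degree :: "(nat \<Rightarrow>\<^sub>0 nat) \<Rightarrow> nat" where
  "monom_degree m = (\<Sum>j\<in>Poly_Mapping.keys m. Poly_Mapping.lookup m j)"

definition hom_comp :: "nat \<Rightarrow> 'k::field mpol \<Rightarrow> 'k mpol" where
  "hom_comp d p = Poly_Mapping.mapp (\<lambda>m c. if monom_degree m = d then c else 0) p"

definition hom_polys :: "nat \<Rightarrow> nat \<Rightarrow> 'k::field mpol set" where
  "hom_polys n d =
    {p \<in> carrier (mpol_ring n). \<forall>m \<in> Poly_Mapping.keys p. monom_degree m = d}"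

definition homogeneous_ideal :: "nat \<Rightarrow> 'k::field mpol set \<Rightarrow> bool" where
  "homogeneous_ideal n I \<longleftrightarrow>
    ideal I (mpol_ring n) \<and> (\<forall>p\<in>I. \<forall>d. hom_comp d p \<in> I)"

text \<open>
  A standard graded algebra is given by a presentation: a number \<open>n\<close> of variables together
  with a homogeneous ideal \<open>I\<close> of the polynomial ring in \<open>n\<close> variables. The ideal may
  contain linear forms, so \<open>n\<close> need not be the codimension.
\<close>

definition galg :: "nat \<Rightarrow> 'k::field mpol set \<Rightarrow> 'k mpol set ring" where
  "galg n I = mpol_ring n Quot I"

definition residue_class :: "nat \<Rightarrow> 'k::field mpol set \<Rightarrow> 'k mpol \<Rightarrow> 'k mpol set" where
  "residue_class n I p = I +>\<^bsub>mpol_ring n\<^esub> p"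

text \<open>
  HOL-Algebra measures the dimension of a subset of a ring over a subfield of that same ring.
  The field \<open>k\<close> therefore enters as its image in \<open>S/I\<close>, which is a copy of \<open>k\<close>
  as soon as \<open>I\<close> is proper.
\<close>

definition ground_field :: "nat \<Rightarrow> 'k::field mpol set \<Rightarrow> 'k mpol set set" where
  "ground_field n I = residue_class n I ` range mpol_const"

definition graded_piece :: "nat \<Rightarrow> 'k::field mpol set \<Rightarrow> nat \<Rightarrow> 'k mpol set set" where
  "graded_piece n I i = residue_class n I ` hom_polys n i"

definition artinian :: "nat \<Rightarrow> 'k::field mpol set \<Rightarrow> bool" where
  "artinian n I \<longleftrightarrow>
    ring.finite_dimension (galg n I) (ground_field n I) (carrier (galg n I))"

definition hvec :: "nat \<Rightarrow> 'k::field mpol set \<Rightarrow> nat \<Rightarrow> nat" where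
  "hvec n I i = ring.dim (galg n I) (ground_field n I) (graded_piece n I i)"

definition codimension :: "nat \<Rightarrow> 'k::field mpol set \<Rightarrow> nat" where
  "codimension n I = hvec n I 1"

definition has_socle_degree :: "nat \<Rightarrow> 'k::field mpol set \<Rightarrow> nat \<Rightarrow> bool" where
  "has_socle_degree n I e \<longleftrightarrow>
    graded_piece n I e \<noteq> {\<zero>\<^bsub>galg n I\<^esub>} \<and>
    (\<forall>i>e. graded_piece n I i = {\<zero>\<^bsub>galg n I\<^esub>})"

definition socle :: "nat \<Rightarrow> 'k::field mpol set \<Rightarrow> 'k mpol set set" where
  "socle n I =
    {a \<in> carrier (galg n I).
      \<forall>j<n. a \<otimes>\<^bsub>galg n I\<^esub> residue_class n I (mpol_var j) = \<zero>\<^bsub>galg n I\<^esub>}"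

definition artinian_gorenstein :: "nat \<Rightarrow> 'k::field mpol set \<Rightarrow> bool" where
  "artinian_gorenstein n I \<longleftrightarrow>
    homogeneous_ideal n I \<and> artinian n I \<and>
    ring.dimension (galg n I) 1 (ground_field n I) (socle n I)"

definition dim_hom_polys :: "'k::field itself \<Rightarrow> nat \<Rightarrow> nat \<Rightarrow> nat" where
  "dim_hom_polys _ c i =
    ring.dim (mpol_ring c :: 'k mpol ring) (range mpol_const) (hom_polys c i)"

definition compressed_gorenstein :: "nat \<Rightarrow> 'k::field mpol set \<Rightarrow> bool" where
  "compressed_gorenstein n I \<longleftrightarrow>
    artinian_gorenstein n I \<and>
    (\<exists>e. has_socle_degree n I e \<and>
      (\<forall>i\<le>e. hvec n I i =
        min (dim_hom_polys TYPE('k) (codimension n I) i)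
            (dim_hom_polys TYPE('k) (codimension n I) (e - i))))"

definition weak_lefschetz :: "nat \<Rightarrow> 'k::field mpol set \<Rightarrow> bool" where
  "weak_lefschetz n I \<longleftrightarrow>
    (\<exists>L \<in> graded_piece n I 1. \<forall>i.
      inj_on (\<lambda>a. L \<otimes>\<^bsub>galg n I\<^esub> a) (graded_piece n I i) \<or>
      (\<lambda>a. L \<otimes>\<^bsub>galg n I\<^esub> a) ` graded_piece n I i = graded_piece n I (i + 1))"

lemma mpol_ring_simps:
  "carrier (mpol_ring n) = {p. \<forall>m \<in> Poly_Mapping.keys p. Poly_Mapping.keys m \<subseteq> {..<n}}"
  "p \<otimes>\<^bsub>mpol_ring n\<^esub> q = p * q" "p \<oplus>\<^bsub>mpol_ring n\<^esub> q = p + q"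
  "\<one>\<^bsub>mpol_ring n\<^esub> = 1" "\<zero>\<^bsub>mpol_ring n\<^esub> = 0"
  by (simp_all add: mpol_ring_def)

lemma cring_mpol_ring: "cring (mpol_ring n :: 'k::field mpol ring)"
proof -
  let ?C = "carrier (mpol_ring n :: 'k mpol ring)"
  have add: "p + q \<in> ?C" if "p \<in> ?C" "q \<in> ?C" for p q
    using that Poly_Mapping.keys_add[of p q] unfolding mpol_ring_simps by blast
  have mult: "p * q \<in> ?C" if "p \<in> ?C" "q \<in> ?C" for p q
    unfolding mpol_ring_simps
  proof (intro CollectI ballI)
    fix m assume "m \<in> Poly_Mapping.keys (p * q)"
    then obtain a b where "m = a + b" "a \<in> Poly_Mapping.keys p" "b \<in> Poly_Mapping.keys q"
      using keys_mult[of p q] by blast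
    then show "Poly_Mapping.keys m \<subseteq> {..<n}"
      using that Poly_Mapping.keys_add[of a b] unfolding mpol_ring_simps by blast
  qed
  have uminus: "- p \<in> ?C" if "p \<in> ?C" for p
    using that by (simp add: mpol_ring_simps)
  have const: "0 \<in> ?C" "1 \<in> ?C"
    by (simp_all add: mpol_ring_simps)
  show ?thesis
  proof (rule cringI)
    show "abelian_group (mpol_ring n :: 'k mpol ring)"
    proof (rule abelian_groupI)
      fix p assume "p \<in> ?C"
      then show "\<exists>q\<in>?C. q \<oplus>\<^bsub>mpol_ring n\<^esub> p = \<zero>\<^bsub>mpol_ring n\<^esub>"
        by (intro bexI[OF _ uminus]) (simp_all only: mpol_ring_simps(2-5) left_minus)
    qed (use add const in \<open>simp_all only: mpol_ring_simps(2-5) ac_simps add_0_left add_0_right\<close>)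
    show "comm_monoid (mpol_ring n :: 'k mpol ring)"
      by (rule comm_monoidI)
        (use mult const in \<open>simp_all only: mpol_ring_simps(2-5) ac_simps mult_1_left mult_1_right\<close>)
  qed (simp only: mpol_ring_simps(2-5) distrib_right)
qed

end

theory Submission
  imports Defs
begin

text \<open>
  An artinian Gorenstein algebra \<open>A\<close> of socle degree \<open>e\<close> is determined by a linear functional
  \<open>\<phi>\<close> on the forms of degree \<open>e\<close>: a form \<open>p\<close> of degree \<open>i\<close> is zero in \<open>A\<close> iff $\varphi(pq) = 0$ for
  all forms \<open>q\<close> of degree $e - i$. By duality, for $e = 2m + 1$ or $e = 2m + 2$, the Weak Lefschetz
  Property says that some linear form \<open>L\<close> acts injectively from degree \<open>m\<close> to degree $m + 1$.

  If $e = 2m + 1$, add to \<open>\<phi>\<close> evaluations at $\dim I_m$ points such that no nonzero element of $I_m$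
  vanishes at all of them. This gives a compressed algebra, and a Lefschetz element of it is one of
  \<open>A\<close>. If $e = 2m + 2$, take \<open>L\<close> with minimal kernel \<open>K\<close> on $A_m$. The odd case applied to
  $\varphi(L \cdot)$ shows that general linear forms have kernel \<open>K\<close> as well, so all linear forms
  kill \<open>K\<close>. As the socle is $A_e$, this gives $K = 0$.
\<close>

section \<open>Forms and monomials\<close>

text \<open>Evaluations at points suit the perturbation because they are multiplicative: a product
  \<open>p * q\<close> receives the term \<open>p(x) q(x)\<close>. A test form
  \<open>x_l g_j\<close> isolates one point, and there \<phi> contributes nothing because
  \<open>g_j\<close> lies in its ideal; no divided powers and no condition on the characteristic
  enter. Isolating a point needs a form of positive degree, so the middle degree 0, that is socle
  degree 1 or 2, is treated directly. The obstacle in even socle degree is that a Lefschetz element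
  for \<phi>(L .) does not make \<open>L\<close> injective; it only shows that a second linear
  factor leaves the kernel of \<open>L\<close> unchanged. Minimality replaces genericity: instead of
  Zariski-open sets there are pencils \<open>L' + t M\<close> with finitely many bad
  \<open>t\<close>, which is where infinitely many scalars are used. A compressed algebra in
  \<open>c\<close> variables should have codimension \<open>c\<close>, while the given ideal may
  contain linear forms, so the algebra is transported to a basis of A_1. The codimension never
  changes in the argument, which therefore works in each codimension separately.\<close>

definition cscale :: "'k::field \<Rightarrow> 'k mpol \<Rightarrow> 'k mpol" where
  "cscale c p = mpol_const c * p"

definition monoms :: "nat \<Rightarrow> nat \<Rightarrow> (nat \<Rightarrow>\<^sub>0 nat) set" where
  "monoms n i = {m. Poly_Mapping.keys m \<subseteq> {..<n} \<and> monom_degree m = i}"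

lemma lookup_cscale [simp]:
  "Poly_Mapping.lookup (cscale c p) m = c * Poly_Mapping.lookup p m"
  unfolding cscale_def mpol_const_def mult_map_scale_conv_mult[symmetric]
  by (simp add: Poly_Mapping.map.rep_eq when_def)

text \<open>Spans, independence and dimension are handled in this type-based vector space. The
  dimensions of HOL-Algebra, taken over the image of \<open>k\<close> in the quotient, are obtained
  from such spans by \<open>dimension_image_span\<close>.\<close>

global_interpretation mp: vector_space "cscale :: 'k::field \<Rightarrow> 'k mpol \<Rightarrow> 'k mpol"
  by unfold_locales (auto intro!: poly_mapping_eqI simp: lookup_add algebra_simps)

lemma cscale_mult_left: "cscale c p * q = cscale c (p * q)"
  and cscale_mult_right: "p * cscale c q = cscale c (p * q)"
  by (simp_all add: cscale_def ac_simps)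

lemma mpol_expand:
  "p = (\<Sum>m\<in>Poly_Mapping.keys p. cscale (Poly_Mapping.lookup p m) (Poly_Mapping.single m 1))"
proof (rule poly_mapping_eqI)
  fix k
  show "Poly_Mapping.lookup p k = Poly_Mapping.lookup
    (\<Sum>m\<in>Poly_Mapping.keys p. cscale (Poly_Mapping.lookup p m) (Poly_Mapping.single m 1)) k"
    by (simp add: lookup_sum lookup_single when_def if_distrib[of "(*) _"] in_keys_iff
        cong: if_cong)
qed

lemma monom_degree_superset:
  assumes "finite A" "Poly_Mapping.keys m \<subseteq> A"
  shows "monom_degree m = (\<Sum>j\<in>A. Poly_Mapping.lookup m j)"
  unfolding monom_degree_def using assms
  by (intro sum.mono_neutral_left) (auto simp: in_keys_iff)

lemma monom_degree_add: "monom_degree (a + b) = monom_degree a + monom_degree b"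
proof -
  let ?A = "Poly_Mapping.keys a \<union> Poly_Mapping.keys b"
  have "monom_degree (a + b) = (\<Sum>j\<in>?A. Poly_Mapping.lookup (a + b) j)"
    using Poly_Mapping.keys_add[of a b] by (intro monom_degree_superset) auto
  also have "\<dots> = monom_degree a + monom_degree b"
    by (simp add: lookup_add sum.distrib monom_degree_superset[of ?A])
  finally show ?thesis .
qed

lemma monom_degree_0 [simp]: "monom_degree 0 = 0"
  by (simp add: monom_degree_def)

lemma monom_degree_single [simp]: "monom_degree (Poly_Mapping.single j d) = d"
  by (cases "d = 0") (simp_all add: monom_degree_def)

lemma monoms_0: "monoms n 0 = {0}"
  by (auto simp: monoms_def monom_degree_def in_keys_iff intro!: poly_mapping_eqI)

lemma monoms_add: "a \<in> monoms n i \<Longrightarrow> b \<in> monoms n j \<Longrightarrow> a + b \<in> monoms n (i + j)"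
  using Poly_Mapping.keys_add[of a b] by (auto simp: monoms_def monom_degree_add)

lemma single_in_monoms: "j < n \<Longrightarrow> Poly_Mapping.single j d \<in> monoms n d"
  by (auto simp: monoms_def split: if_splits)

lemma monoms_SucE:
  assumes "m \<in> monoms n (Suc i)"
  obtains j m' where "j < n" "m' \<in> monoms n i" "m = Poly_Mapping.single j 1 + m'"
proof -
  from assms have "m \<noteq> 0" by (auto simp: monoms_def)
  then obtain j where j: "j \<in> Poly_Mapping.keys m"
    by (metis all_not_in_conv keys_eq_empty)
  define m' where "m' = m - Poly_Mapping.single j 1"
  have eq: "m = Poly_Mapping.single j 1 + m'"
    using j by (intro poly_mapping_eqI)
      (auto simp: m'_def lookup_add lookup_minus lookup_single when_def in_keys_iff)
  have "Poly_Mapping.keys m' \<subseteq> Poly_Mapping.keys m"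
    by (auto simp: m'_def in_keys_iff lookup_minus)
  moreover have "monom_degree m' = i"
    using assms monom_degree_add[of "Poly_Mapping.single j 1" m'] eq by (simp add: monoms_def)
  ultimately show ?thesis
    using that[of j m'] eq j assms by (auto simp: monoms_def)
qed

lemma finite_monoms: "finite (monoms n i)"
proof (induction i)
  case 0
  then show ?case by (simp add: monoms_0)
next
  case (Suc i)
  have "monoms n (Suc i) \<subseteq> (\<Union>j<n. (\<lambda>m. Poly_Mapping.single j 1 + m) ` monoms n i)"
    by (force elim: monoms_SucE)
  then show ?case
    using Suc by (meson finite_UN_I finite_imageI finite_lessThan finite_subset)
qed

lemma monoms_1: "monoms n 1 = (\<lambda>j. Poly_Mapping.single j 1) ` {..<n}"
proof
  show "monoms n 1 \<subseteq> (\<lambda>j. Poly_Mapping.single j 1) ` {..<n}"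
    by (auto simp: monoms_0 elim!: monoms_SucE[of _ n 0, simplified])
qed (auto intro: single_in_monoms)

lemma card_monoms_1: "card (monoms n 1) = n"
proof -
  have "inj_on (\<lambda>j. Poly_Mapping.single j (1::nat)) {..<n}"
    by (rule inj_onI) (metis lookup_single_eq lookup_single_not_eq zero_neq_one)
  then show ?thesis
    by (simp add: monoms_1 card_image del: One_nat_def)
qed

lemma card_monoms_mono:
  assumes "0 < n" "i \<le> j"
  shows "card (monoms n i) \<le> card (monoms n j)"
proof (rule card_inj_on_le)
  let ?s = "Poly_Mapping.single (0::nat) (j - i)"
  show "(\<lambda>m. ?s + m) ` monoms n i \<subseteq> monoms n j"
    using assms monoms_add[OF single_in_monoms[of 0 n "j - i"], of _ i] by auto
qed (auto simp: finite_monoms)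

lemma keys_hom_polys: "p \<in> hom_polys n i \<longleftrightarrow> Poly_Mapping.keys p \<subseteq> monoms n i"
  by (auto simp: hom_polys_def monoms_def mpol_ring_simps)

lemma keys_carrier: "p \<in> carrier (mpol_ring n) \<longleftrightarrow> Poly_Mapping.keys p \<subseteq> (\<Union>i. monoms n i)"
  by (auto simp: monoms_def mpol_ring_simps)

lemma subspace_keys: "mp.subspace {p. Poly_Mapping.keys p \<subseteq> A}"
  by (auto simp: mp.subspace_def subset_iff in_keys_iff lookup_add)
     (metis add.right_neutral)

lemma keys_subset_eq_span:
  "{p :: 'k::field mpol. Poly_Mapping.keys p \<subseteq> A} = mp.span ((\<lambda>m. Poly_Mapping.single m 1) ` A)"
    (is "?L = ?R")
proof
  show "?L \<subseteq> ?R"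
  proof
    fix p :: "'k mpol" assume "p \<in> ?L"
    then have "(\<Sum>m\<in>Poly_Mapping.keys p. cscale (Poly_Mapping.lookup p m)
        (Poly_Mapping.single m 1)) \<in> ?R"
      by (intro mp.span_sum mp.span_scale mp.span_base) auto
    then show "p \<in> ?R"
      using mpol_expand[of p] by simp
  qed
  show "?R \<subseteq> ?L"
    by (rule mp.span_minimal[OF _ subspace_keys]) auto
qed

lemma hom_polys_eq_span: "hom_polys n i = mp.span ((\<lambda>m. Poly_Mapping.single m 1) ` monoms n i)"
  unfolding keys_subset_eq_span[symmetric] by (auto simp: keys_hom_polys)

lemma carrier_eq_span:
  "carrier (mpol_ring n) = mp.span ((\<lambda>m. Poly_Mapping.single m 1) ` (\<Union>i. monoms n i))"
  unfolding keys_subset_eq_span[symmetric] by (simp add: set_eq_iff keys_carrier)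

lemma subspace_hom_polys: "mp.subspace (hom_polys n i)"
  by (simp add: hom_polys_eq_span)

lemma zero_in_hom_polys [simp]: "0 \<in> hom_polys n i"
  by (rule mp.subspace_0[OF subspace_hom_polys])

lemma subspace_carrier: "mp.subspace (carrier (mpol_ring n))"
  by (simp add: carrier_eq_span)

lemma single_in_hom_polys: "m \<in> monoms n i \<Longrightarrow> Poly_Mapping.single m 1 \<in> hom_polys n i"
  by (simp add: keys_hom_polys)

lemma var_in_hom_polys: "j < n \<Longrightarrow> mpol_var j \<in> hom_polys n 1"
  by (simp add: mpol_var_def single_in_hom_polys single_in_monoms)

lemma hom_polys_carrier: "p \<in> hom_polys n i \<Longrightarrow> p \<in> carrier (mpol_ring n)"
  by (simp add: hom_polys_def)

lemma hom_polys_mult: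
  assumes "p \<in> hom_polys n i" "q \<in> hom_polys n j"
  shows "p * q \<in> hom_polys n (i + j)"
  using assms Poly_Mapping.keys_mult[of p q] monoms_add unfolding keys_hom_polys by blast

lemma carrier_mult:
  assumes "p \<in> carrier (mpol_ring n)" "q \<in> carrier (mpol_ring n)"
  shows "p * q \<in> carrier (mpol_ring n)"
  using monoid.m_closed[OF ring.is_monoid[OF cring.axioms(1)[OF cring_mpol_ring]] assms]
  by (simp add: mpol_ring_simps)

lemma const_in_hom_polys: "mpol_const c \<in> hom_polys n 0"
  by (auto simp: mpol_const_def keys_hom_polys monoms_0)

lemma one_in_hom_polys: "1 \<in> hom_polys n 0"
  using const_in_hom_polys[of 1 n] by (simp add: mpol_const_def)

lemma hom_polys_Suc_eq_span:
  "hom_polys n (Suc i) = mp.span {mpol_var j * p | j p. j < n \<and> p \<in> hom_polys n i}" (is "_ = ?R")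
proof
  show "hom_polys n (Suc i) \<subseteq> ?R"
    unfolding hom_polys_eq_span[of n "Suc i"]
  proof (rule mp.span_mono, clarify)
    fix m assume "m \<in> monoms n (Suc i)"
    then obtain j m' where *: "j < n" "m' \<in> monoms n i" "m = Poly_Mapping.single j 1 + m'"
      by (rule monoms_SucE)
    then show "\<exists>j p. Poly_Mapping.single m 1 = mpol_var j * p \<and> j < n \<and> p \<in> hom_polys n i"
      by (intro exI[of _ j] exI[of _ "Poly_Mapping.single m' 1"])
        (auto simp: mpol_var_def mult_single single_in_hom_polys)
  qed
  show "?R \<subseteq> hom_polys n (Suc i)"
    using hom_polys_mult[OF var_in_hom_polys]
    by (intro mp.span_minimal subspace_hom_polys) fastforce
qed

text \<open>This rule and the next two replace calculations with coefficients: a condition that is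
  linear in the polynomial needs checking only on a spanning set.\<close>

lemma hom_polys_induct [consumes 1, case_names subspace monom]:
  assumes "p \<in> hom_polys n i" "mp.subspace {p. P p}"
    and "\<And>m. m \<in> monoms n i \<Longrightarrow> P (Poly_Mapping.single m 1)"
  shows "P p"
proof -
  have "hom_polys n i \<subseteq> {p. P p}"
    unfolding hom_polys_eq_span using assms by (intro mp.span_minimal) auto
  then show ?thesis using assms by auto
qed

lemma carrier_induct [consumes 1, case_names subspace homogeneous]:
  assumes "p \<in> carrier (mpol_ring n)" "mp.subspace {p. P p}"
    and "\<And>q i. q \<in> hom_polys n i \<Longrightarrow> P q"
  shows "P p"
proof -
  have "carrier (mpol_ring n) \<subseteq> {p. P p}"
    unfolding carrier_eq_span using assms(2,3) single_in_hom_polys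
    by (intro mp.span_minimal) fastforce+
  then show ?thesis using assms by auto
qed

lemma hom_polys_Suc_induct [consumes 1, case_names subspace var]:
  assumes "p \<in> hom_polys n (Suc i)" "mp.subspace {p. P p}"
    and "\<And>j q. j < n \<Longrightarrow> q \<in> hom_polys n i \<Longrightarrow> P (mpol_var j * q)"
  shows "P p"
proof -
  have "hom_polys n (Suc i) \<subseteq> {p. P p}"
    unfolding hom_polys_Suc_eq_span using assms by (intro mp.span_minimal) auto
  then show ?thesis using assms by auto
qed

lemma lookup_hom_comp:
  "Poly_Mapping.lookup (hom_comp d p) m = (if monom_degree m = d then Poly_Mapping.lookup p m else 0)"
  by (simp add: hom_comp_def lookup_mapp when_def in_keys_iff)

lemma hom_comp_add: "hom_comp d (p + q) = hom_comp d p + hom_comp d q"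
  and hom_comp_minus: "hom_comp d (p - q) = hom_comp d p - hom_comp d q"
  and hom_comp_cscale: "hom_comp d (cscale c p) = cscale c (hom_comp d p)"
  and hom_comp_0: "hom_comp d 0 = 0"
  by (auto intro!: poly_mapping_eqI simp: lookup_hom_comp lookup_add lookup_minus)

lemma hom_comp_hom_polys:
  assumes "p \<in> hom_polys n i"
  shows "hom_comp d p = (if d = i then p else 0)"
  using assms by (auto intro!: poly_mapping_eqI
      simp: lookup_hom_comp keys_hom_polys in_keys_iff subset_iff monoms_def)

lemma hom_comp_in_hom_polys:
  "p \<in> carrier (mpol_ring n) \<Longrightarrow> hom_comp d p \<in> hom_polys n d"
  by (auto simp: keys_hom_polys in_keys_iff lookup_hom_comp keys_carrier monoms_def subset_iff)

lemma subspace_hom_comp_zero: "mp.subspace {p. hom_comp d p = 0}"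
  by (auto simp: mp.subspace_def hom_comp_add hom_comp_cscale hom_comp_0)

section \<open>Biorthogonal systems, substitution and points\<close>

context vector_space
begin

text \<open>Among the families $g_i \<in> V$, $x_i \<in> X$ with $f_{x_i}(g_j) = \delta_{ij}$ take one of
  maximal length: a vector of \<open>V\<close> killed by all $f_{x_i}$ but not by some $f_y$ would extend it.\<close>

lemma biorthogonal_system:
  fixes f :: "'x \<Rightarrow> 'b \<Rightarrow> 'a"
  assumes V: "subspace V" and B: "finite B" "V \<subseteq> span B"
    and add: "\<And>y u v. y \<in> X \<Longrightarrow> f y (u + v) = f y u + f y v"
    and sc: "\<And>y c v. y \<in> X \<Longrightarrow> f y (c *s v) = c * f y v"
  obtains d :: nat and g x where
    "\<And>i. i < d \<Longrightarrow> g i \<in> V" "\<And>i. i < d \<Longrightarrow> x i \<in> X"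
    "\<And>i j. i < d \<Longrightarrow> j < d \<Longrightarrow> f (x i) (g j) = (if i = j then 1 else 0)"
    "\<And>v y. v \<in> V \<Longrightarrow> y \<in> X \<Longrightarrow> f y (v - (\<Sum>i<d. f (x i) v *s g i)) = 0"
proof -
  define P where "P d \<longleftrightarrow> (\<exists>g x. (\<forall>i<d. g i \<in> V \<and> x i \<in> X) \<and>
    (\<forall>i<d. \<forall>j<d. f (x i) (g j) = (if i = j then 1 else 0)))" for d :: nat
  have f0: "f y 0 = 0" if "y \<in> X" for y
    using sc[OF that, of 0 0] by simp
  have fdiff: "f y (u - v) = f y u - f y v" if "y \<in> X" for y u v
    using add[OF that, of "u - v" v] by simp
  have fsum: "f y (sum h A) = (\<Sum>i\<in>A. f y (h i))" if "y \<in> X" for y h and A :: "nat set"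
    by (induction A rule: infinite_finite_induct) (simp_all add: f0 add that)
  have bound: "d \<le> card B" if "P d" for d
  proof -
    from that obtain g x where gx: "\<And>i. i < d \<Longrightarrow> g i \<in> V \<and> x i \<in> X"
      and fg: "\<And>i j. i < d \<Longrightarrow> j < d \<Longrightarrow> f (x i) (g j) = (if i = j then 1 else 0)"
      unfolding P_def by blast
    have inj: "inj_on g {..<d}"
    proof (rule inj_onI)
      fix i j assume "i \<in> {..<d}" "j \<in> {..<d}" "g i = g j"
      then show "i = j" using fg[of i i] fg[of i j] by (auto split: if_splits)
    qed
    have "independent (g ` {..<d})"
    proof (rule independent_if_scalars_zero)
      fix u v assume 0: "(\<Sum>v\<in>g ` {..<d}. u v *s v) = 0" and "v \<in> g ` {..<d}"
      then obtain j where j: "j < d" "v = g j" by auto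
      have "0 = f (x j) (\<Sum>i<d. u (g i) *s g i)"
        using 0 f0[of "x j"] gx[OF j(1)] by (simp add: sum.reindex[OF inj])
      also have "\<dots> = (\<Sum>i<d. u (g i) * f (x j) (g i))"
        using gx[OF j(1)] by (simp add: fsum sc)
      also have "\<dots> = (\<Sum>i<d. if i = j then u (g i) else 0)"
        using fg j by (intro sum.cong) auto
      also have "\<dots> = u v" using j by simp
      finally show "u v = 0" by simp
    qed simp
    moreover have "g ` {..<d} \<subseteq> span B" using gx B by auto
    ultimately have "card (g ` {..<d}) \<le> card B"
      using independent_span_bound[OF B(1)] by blast
    then show ?thesis by (simp add: card_image[OF inj])
  qed
  have "P 0" by (simp add: P_def)
  then obtain d where "P d" and max: "\<And>d'. P d' \<Longrightarrow> d' \<le> d"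
    using Nat.ex_has_greatest_nat[of P 0 "card B"] bound by blast
  then obtain g x where gx: "\<And>i. i < d \<Longrightarrow> g i \<in> V \<and> x i \<in> X"
      and fg: "\<And>i j. i < d \<Longrightarrow> j < d \<Longrightarrow> f (x i) (g j) = (if i = j then 1 else 0)"
      unfolding P_def by blast
  have complete: "f y v = 0"
    if v: "v \<in> V" and y: "y \<in> X" and 0: "\<And>i. i < d \<Longrightarrow> f (x i) v = 0" for v y
  proof (rule ccontr)
    assume nz: "f y v \<noteq> 0"
    define w where "w = inverse (f y v) *s v"
    have w: "w \<in> V" "f y w = 1" "\<And>i. i < d \<Longrightarrow> f (x i) w = 0"
      using v y nz 0 gx by (auto simp: w_def sc V subspace_scale)
    \<comment> \<open>Subtracting a multiple of \<open>w\<close> makes \<open>y\<close> vanish on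
      the old vectors, and it preserves the old relations because every \<open>x i\<close> kills
      \<open>w\<close>.\<close>
    define g' where "g' i = (if i < d then g i - f y (g i) *s w else w)" for i
    define x' where "x' i = (if i < d then x i else y)" for i
    have "P (Suc d)"
      unfolding P_def
    proof (intro exI[of _ g'] exI[of _ x'] conjI allI impI)
      fix i assume "i < Suc d"
      then show "g' i \<in> V" "x' i \<in> X"
        using gx w y V by (auto simp: g'_def x'_def subspace_diff subspace_scale)
    next
      fix i j assume "i < Suc d" "j < Suc d"
      then show "f (x' i) (g' j) = (if i = j then 1 else 0)"
        using w gx y fg by (auto simp: g'_def x'_def fdiff sc less_Suc_eq)
    qed
    then show False using max by fastforce
  qed
  show ?thesis
  proof (rule that[of d g x])
    fix v y assume v: "v \<in> V" and y: "y \<in> X"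
    show "f y (v - (\<Sum>i<d. f (x i) v *s g i)) = 0"
    proof (rule complete[OF _ y])
      show "v - (\<Sum>i<d. f (x i) v *s g i) \<in> V"
        using V v gx by (intro subspace_diff subspace_sum subspace_scale) auto
      fix j assume j: "j < d"
      have "(\<Sum>i<d. f (x i) v * f (x j) (g i)) = (\<Sum>i<d. if i = j then f (x i) v else 0)"
        using fg j by (intro sum.cong) auto
      then show "f (x j) (v - (\<Sum>i<d. f (x i) v *s g i)) = 0"
        using gx[OF j] j by (simp add: fdiff fsum sc)
    qed
  qed (use gx fg in auto)
qed

end

section \<open>Substitution homomorphisms and nonvanishing points\<close>

definition monom_eval :: "(nat \<Rightarrow> 'a::comm_ring_1) \<Rightarrow> (nat \<Rightarrow>\<^sub>0 nat) \<Rightarrow> 'a" where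
  "monom_eval x m = (\<Prod>j\<in>Poly_Mapping.keys m. x j ^ Poly_Mapping.lookup m j)"

text \<open>The coefficient map \<open>h\<close> lets one definition serve twice: with the identity
  it is evaluation at a point of \<open>k\<close>, with \<open>mpol_const\<close> it is a change of
  variables between polynomial rings.\<close>

definition subst :: "('k::field \<Rightarrow> 'a::comm_ring_1) \<Rightarrow> (nat \<Rightarrow> 'a) \<Rightarrow> 'k mpol \<Rightarrow> 'a" where
  "subst h x p = (\<Sum>m\<in>Poly_Mapping.keys p. h (Poly_Mapping.lookup p m) * monom_eval x m)"

lemma monom_eval_superset:
  assumes "finite A" "Poly_Mapping.keys m \<subseteq> A"
  shows "monom_eval x m = (\<Prod>j\<in>A. x j ^ Poly_Mapping.lookup m j)"
  unfolding monom_eval_def using assms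
  by (intro prod.mono_neutral_left) (auto simp: in_keys_iff)

lemma monom_eval_add: "monom_eval x (a + b) = monom_eval x a * monom_eval x b"
proof -
  let ?A = "Poly_Mapping.keys a \<union> Poly_Mapping.keys b"
  have "monom_eval x (a + b) = (\<Prod>j\<in>?A. x j ^ Poly_Mapping.lookup (a + b) j)"
    using Poly_Mapping.keys_add[of a b] by (intro monom_eval_superset) auto
  also have "\<dots> = monom_eval x a * monom_eval x b"
    by (simp add: lookup_add power_add prod.distrib monom_eval_superset[of ?A])
  finally show ?thesis .
qed

lemma monom_eval_0 [simp]: "monom_eval x 0 = 1"
  by (simp add: monom_eval_def)

lemma monom_eval_single [simp]: "monom_eval x (Poly_Mapping.single j 1) = x j"
  by (simp add: monom_eval_def)

locale coeff_hom =
  fixes h :: "'k::field \<Rightarrow> 'a::comm_ring_1"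
  assumes hom_add: "h (a + b) = h a + h b" and hom_mult: "h (a * b) = h a * h b" and hom_1: "h 1 = 1"
begin

lemma hom_0: "h 0 = 0"
  using hom_add[of 0 0] by simp

lemma subst_superset:
  assumes "finite A" "Poly_Mapping.keys p \<subseteq> A"
  shows "subst h x p = (\<Sum>m\<in>A. h (Poly_Mapping.lookup p m) * monom_eval x m)"
  unfolding subst_def using assms
  by (intro sum.mono_neutral_left) (auto simp: in_keys_iff hom_0)

lemma subst_add: "subst h x (p + q) = subst h x p + subst h x q"
proof -
  let ?A = "Poly_Mapping.keys p \<union> Poly_Mapping.keys q"
  have "subst h x (p + q) = (\<Sum>m\<in>?A. h (Poly_Mapping.lookup (p + q) m) * monom_eval x m)"
    using Poly_Mapping.keys_add[of p q] by (intro subst_superset) auto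
  also have "\<dots> = subst h x p + subst h x q"
    by (simp add: lookup_add hom_add algebra_simps sum.distrib subst_superset[of ?A])
  finally show ?thesis .
qed

lemma subst_single: "subst h x (Poly_Mapping.single m c) = h c * monom_eval x m"
  by (simp add: subst_def hom_0)

lemma subst_0 [simp]: "subst h x 0 = 0"
  by (simp add: subst_def)

lemma subst_cscale: "subst h x (cscale c p) = h c * subst h x p"
proof -
  have "subst h x (cscale c p) =
      (\<Sum>m\<in>Poly_Mapping.keys p. h (Poly_Mapping.lookup (cscale c p) m) * monom_eval x m)"
    by (rule subst_superset) (auto simp: in_keys_iff)
  then show ?thesis
    by (simp add: hom_mult sum_distrib_left subst_def mult.assoc)
qed

lemma subst_1: "subst h x 1 = 1"
  using subst_single[of x 0 1] by (simp add: hom_1)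

lemma subst_var: "subst h x (mpol_var j) = x j"
  using subst_single[of x "Poly_Mapping.single j 1" 1] by (simp add: mpol_var_def hom_1 del: One_nat_def)

lemma subst_mult_single:
  "subst h x (Poly_Mapping.single m 1 * q) = monom_eval x m * subst h x q"
proof -
  have "mp.subspace {q. subst h x (Poly_Mapping.single m 1 * q) = monom_eval x m * subst h x q}"
    by (auto simp: mp.subspace_def distrib_left subst_add subst_cscale cscale_mult_right
        mult.left_commute)
  then have "mp.span (range (\<lambda>m'. Poly_Mapping.single m' 1)) \<subseteq>
      {q. subst h x (Poly_Mapping.single m 1 * q) = monom_eval x m * subst h x q}"
    by (intro mp.span_minimal)
      (auto simp: mult_single subst_single monom_eval_add hom_1)
  then show ?thesis
    using keys_subset_eq_span[of UNIV] by auto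
qed

lemma subst_mult: "subst h x (p * q) = subst h x p * subst h x q"
proof -
  have "mp.subspace {p. subst h x (p * q) = subst h x p * subst h x q}"
    by (auto simp: mp.subspace_def distrib_right subst_add subst_cscale cscale_mult_left mult.assoc)
  then have "mp.span (range (\<lambda>m'. Poly_Mapping.single m' 1)) \<subseteq>
      {p. subst h x (p * q) = subst h x p * subst h x q}"
    by (intro mp.span_minimal) (auto simp: subst_mult_single subst_single hom_1)
  then show ?thesis
    using keys_subset_eq_span[of UNIV] by auto
qed

end

interpretation id_coeff: coeff_hom "\<lambda>c. c :: 'k::field"
  by unfold_locales auto

interpretation const_coeff: coeff_hom "mpol_const :: 'k::field \<Rightarrow> 'k mpol"
  by unfold_locales (simp_all add: mpol_const_def single_add mult_single)

text \<open>Over a finite field, one plus the product of all \<open>X - a\<close> has positive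
  degree but takes the value 1 everywhere, so it has no root.\<close>

lemma infinite_UNIV_alg_closed: "infinite (UNIV :: 'k::alg_closed_field set)"
proof
  assume fin: "finite (UNIV :: 'k set)"
  define p where "p = (\<Prod>a\<in>(UNIV :: 'k set). [:- a, 1:]) + 1"
  have deg: "degree (\<Prod>a\<in>(UNIV :: 'k set). [:- a, 1:]) = card (UNIV :: 'k set)"
    by (subst degree_prod_eq_sum_degree) auto
  have "card (UNIV :: 'k set) > 0" using fin by (simp add: finite_UNIV_card_ge_0)
  then have "degree p > 0"
    using deg by (simp add: p_def degree_add_eq_left)
  then obtain x where "poly p x = 0" using alg_closed_imp_poly_has_root by blast
  moreover have "poly (\<Prod>a\<in>(UNIV :: 'k set). [:- a, 1:]) x = 0"
    using fin by (auto simp: poly_prod)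
  ultimately show False by (simp add: p_def)
qed

text \<open>Reduction modulo \<open>D\<close> recovers the lowest digit, and division by
  \<open>D\<close> leaves the rest. This keeps the exponents of the Kronecker substitution
  distinct.\<close>

lemma digits_unique:
  fixes D :: nat
  assumes "\<And>j. a j < D" "\<And>j. b j < D" "(\<Sum>j<N. a j * D ^ j) = (\<Sum>j<N. b j * D ^ j)" "i < N"
  shows "a i = b i"
  using assms
proof (induction N arbitrary: a b i)
  case (Suc N)
  have shift: "(\<Sum>j<Suc N. c j * D ^ j) = c 0 + D * (\<Sum>j<N. c (Suc j) * D ^ j)" for c :: "nat \<Rightarrow> nat"
    by (simp only: sum.lessThan_Suc_shift) (simp add: sum_distrib_left algebra_simps)
  have eq: "a 0 + D * (\<Sum>j<N. a (Suc j) * D ^ j) = b 0 + D * (\<Sum>j<N. b (Suc j) * D ^ j)"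
    using Suc.prems(3) unfolding shift .
  have 0: "a 0 = b 0"
    using arg_cong[OF eq, of "\<lambda>t. t mod D"] Suc.prems(1,2) by simp
  moreover have "D > 0" using Suc.prems(1)[of 0] by simp
  ultimately have "(\<Sum>j<N. a (Suc j) * D ^ j) = (\<Sum>j<N. b (Suc j) * D ^ j)"
    using eq by simp
  then have "a (Suc j) = b (Suc j)" if "j < N" for j
    using Suc.IH[of "\<lambda>j. a (Suc j)" "\<lambda>j. b (Suc j)" j] Suc.prems(1,2) that by blast
  then show ?case using 0 Suc.prems(4) by (cases i) auto
qed simp

text \<open>Kronecker substitution $x_j = t^{D^j}$, with \<open>D\<close> larger than all exponents, reduces to one
  variable.\<close>

lemma exists_nonzero_point:
  fixes p :: "'k::field mpol"
  assumes inf: "infinite (UNIV :: 'k set)" and "p \<noteq> 0"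
  shows "\<exists>x. subst (\<lambda>c. c) x p \<noteq> 0"
proof -
  let ?K = "Poly_Mapping.keys p" and ?lk = "Poly_Mapping.lookup :: (nat \<Rightarrow>\<^sub>0 nat) \<Rightarrow> nat \<Rightarrow> nat"
  define J where "J = \<Union> (Poly_Mapping.keys ` ?K)"
  \<comment> \<open>The inserted 0 keeps both maxima defined when \<open>p\<close> is constant;
    \<open>Suc\<close> makes the bounds on variables and exponents strict.\<close>
  define N where "N = Suc (Max (insert 0 J))"
  define D where "D = Suc (Max (insert 0 ((\<lambda>(m, j). ?lk m j) ` (?K \<times> J))))"
  have "finite J" by (simp add: J_def)
  have N: "j < N" if "m \<in> ?K" "j \<in> Poly_Mapping.keys m" for m j
    using that \<open>finite J\<close> by (auto simp: N_def J_def less_Suc_eq_le intro!: Max_ge)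
  have D: "?lk m j < D" if "m \<in> ?K" for m j
  proof (cases "?lk m j = 0")
    case False
    then have "j \<in> J" using that by (auto simp: J_def in_keys_iff)
    then show ?thesis
      using that \<open>finite J\<close> by (auto simp: D_def less_Suc_eq_le intro!: Max_ge)
  qed (simp add: D_def)
  define ex where "ex m = (\<Sum>j<N. ?lk m j * D ^ j)" for m
  have inj: "inj_on ex ?K"
  proof (rule inj_onI)
    fix a b assume a: "a \<in> ?K" and b: "b \<in> ?K" and eq: "ex a = ex b"
    have "?lk a j = ?lk b j" for j
    proof (cases "j < N")
      case True
      then show ?thesis
        using digits_unique[of "?lk a" D "?lk b" N j] D a b eq by (simp add: ex_def)
    next
      case False
      then have "j \<notin> Poly_Mapping.keys a" "j \<notin> Poly_Mapping.keys b" using N a b by blast+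
      then show ?thesis by (simp add: in_keys_iff)
    qed
    then show "a = b" by (intro poly_mapping_eqI)
  qed
  define P where "P = (\<Sum>m\<in>?K. monom (Poly_Mapping.lookup p m) (ex m))"
  obtain m0 where m0: "m0 \<in> ?K" using \<open>p \<noteq> 0\<close> by (metis all_not_in_conv keys_eq_empty)
  have "coeff P (ex m0) = (\<Sum>m\<in>?K. if m = m0 then Poly_Mapping.lookup p m else 0)"
    unfolding P_def coeff_sum using inj m0 by (intro sum.cong) (auto dest: inj_onD)
  also have "\<dots> \<noteq> 0" using m0 by (simp add: in_keys_iff)
  finally have "P \<noteq> 0" by auto
  then obtain t where t: "poly P t \<noteq> 0"
    using poly_roots_finite inf by (metis (mono_tags, lifting) Collect_cong UNIV_def)
  have "monom_eval (\<lambda>j. t ^ (D ^ j)) m = t ^ ex m" if "m \<in> ?K" for m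
  proof -
    have "monom_eval (\<lambda>j. t ^ (D ^ j)) m = (\<Prod>j<N. (t ^ (D ^ j)) ^ ?lk m j)"
      using N[OF that] by (intro monom_eval_superset) auto
    also have "\<dots> = (\<Prod>j<N. t ^ (?lk m j * D ^ j))"
      by (simp add: power_mult[symmetric] mult.commute)
    finally show ?thesis by (simp add: power_sum ex_def)
  qed
  then have "subst (\<lambda>c. c) (\<lambda>j. t ^ (D ^ j)) p = poly P t"
    by (simp add: subst_def P_def poly_sum poly_monom)
  then show ?thesis using t by metis
qed

lemma subst_hom_polys:
  assumes "p \<in> hom_polys c i" "\<And>j. j < c \<Longrightarrow> g j \<in> hom_polys n 1"
  shows "subst mpol_const g p \<in> hom_polys n i"
  using assms(1)
proof (induction i arbitrary: p)
  case 0
  show ?case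
    using 0
  proof (induction rule: hom_polys_induct)
    case subspace
    have "mp.subspace {p. subst mpol_const g p \<in> hom_polys n 0}"
      using subspace_hom_polys[of n 0]
      by (auto simp: mp.subspace_def const_coeff.subst_add const_coeff.subst_cscale
          cscale_def[symmetric])
    then show ?case .
  next
    case (monom m)
    then show ?case by (simp add: monoms_0 const_coeff.subst_1 one_in_hom_polys)
  qed
next
  case (Suc i)
  show ?case
    using Suc.prems
  proof (induction rule: hom_polys_Suc_induct)
    case subspace
    show ?case
      using subspace_hom_polys[of n "Suc i"]
      by (auto simp: mp.subspace_def const_coeff.subst_add const_coeff.subst_cscale
          cscale_def[symmetric])
  next
    case (var j q)
    then show ?case
      using hom_polys_mult[OF assms(2)[of j] Suc.IH[of q]]
      by (simp add: const_coeff.subst_mult const_coeff.subst_var)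
  qed
qed

section \<open>Residue classes and dimensions\<close>

lemma mpol_ring_minus:
  assumes "p \<in> carrier (mpol_ring n)" "q \<in> carrier (mpol_ring n)"
  shows "p \<ominus>\<^bsub>mpol_ring n\<^esub> q = p - q"
proof -
  interpret cring "mpol_ring n :: 'a mpol ring" by (rule cring_mpol_ring)
  have "- q \<in> carrier (mpol_ring n)"
    using assms(2) by (simp add: mpol_ring_simps)
  then have "\<ominus>\<^bsub>mpol_ring n\<^esub> q = - q"
    using assms(2) by (intro sum_zero_eq_neg[symmetric]) (simp_all add: mpol_ring_simps(2-5))
  then show ?thesis by (simp add: a_minus_def mpol_ring_simps)
qed

locale mpol_ideal =
  fixes n :: nat and I :: "'k::field mpol set"
  assumes is_ideal: "ideal I (mpol_ring n)"
begin

sublocale ideal I "mpol_ring n :: 'k mpol ring"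
  by (rule is_ideal)

lemma mem_carrier: "p \<in> I \<Longrightarrow> p \<in> carrier (mpol_ring n)"
  by (rule a_Hcarr)

lemma mult_mem: "p \<in> I \<Longrightarrow> q \<in> carrier (mpol_ring n) \<Longrightarrow> q * p \<in> I"
  using I_l_closed[of p q] by (simp add: mpol_ring_simps)

lemma mult_mem': "p \<in> I \<Longrightarrow> q \<in> carrier (mpol_ring n) \<Longrightarrow> p * q \<in> I"
  using mult_mem[of p q] by (simp add: mult.commute)

lemma subspace_ideal: "mp.subspace I"
proof (rule mp.subspaceI)
  show "0 \<in> I"
    using additive_subgroup.zero_closed[OF additive_subgroup_axioms] by (simp add: mpol_ring_simps)
  show "p + q \<in> I" if "p \<in> I" "q \<in> I" for p q
    using additive_subgroup.a_closed[OF additive_subgroup_axioms that] by (simp add: mpol_ring_simps)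
  show "cscale c p \<in> I" if "p \<in> I" for c p
    unfolding cscale_def by (rule mult_mem[OF that hom_polys_carrier[OF const_in_hom_polys]])
qed

lemma residue_hom: "ring_hom_ring (mpol_ring n) (galg n I) (residue_class n I)"
  using rcos_ring_hom_ring unfolding galg_def residue_class_def[abs_def] .

lemma ring_galg: "ring (galg n I)"
  unfolding galg_def by (rule quotient_is_ring)

lemma residue_eq_iff:
  assumes "p \<in> carrier (mpol_ring n)" "q \<in> carrier (mpol_ring n)"
  shows "residue_class n I p = residue_class n I q \<longleftrightarrow> p - q \<in> I"
  using quotient_eq_iff_same_a_r_cos[OF is_ideal assms] mpol_ring_minus[OF assms]
  by (simp add: residue_class_def)

lemma carrier_galg: "carrier (galg n I) = residue_class n I ` carrier (mpol_ring n)"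
  by (auto simp: galg_def residue_class_def FactRing_def A_RCOSETS_def' a_r_coset_def)

lemma residue_0: "residue_class n I 0 = \<zero>\<^bsub>galg n I\<^esub>"
  using ring_hom_zero[OF ring_hom_ring.homh[OF residue_hom]
      cring.axioms(1)[OF cring_mpol_ring] ring_galg]
  by (simp add: mpol_ring_simps)

lemma residue_zero_iff:
  assumes "p \<in> carrier (mpol_ring n)"
  shows "residue_class n I p = \<zero>\<^bsub>galg n I\<^esub> \<longleftrightarrow> p \<in> I"
  using residue_eq_iff[OF assms, of 0] residue_0 mp.subspace_0[OF subspace_carrier[of n]] by simp

lemma residue_mult:
  assumes "p \<in> carrier (mpol_ring n)" "q \<in> carrier (mpol_ring n)"
  shows "residue_class n I p \<otimes>\<^bsub>galg n I\<^esub> residue_class n I q = residue_class n I (p * q)"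
  using ring_hom_mult[OF ring_hom_ring.homh[OF residue_hom] assms] by (simp add: mpol_ring_simps)

lemma graded_piece_zero_iff: "graded_piece n I i = {\<zero>\<^bsub>galg n I\<^esub>} \<longleftrightarrow> hom_polys n i \<subseteq> I"
proof -
  have "0 \<in> hom_polys n i" by (rule mp.subspace_0[OF subspace_hom_polys])
  then have "graded_piece n I i = {\<zero>\<^bsub>galg n I\<^esub>} \<longleftrightarrow>
      (\<forall>p\<in>hom_polys n i. residue_class n I p = \<zero>\<^bsub>galg n I\<^esub>)"
    unfolding graded_piece_def by blast
  also have "\<dots> \<longleftrightarrow> hom_polys n i \<subseteq> I"
    using residue_zero_iff hom_polys_carrier by blast
  finally show ?thesis .
qed

lemma has_socle_degree_iff:
  "has_socle_degree n I e \<longleftrightarrow> (\<exists>p\<in>hom_polys n e. p \<notin> I) \<and> (\<forall>i>e. hom_polys n i \<subseteq> I)"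
  unfolding has_socle_degree_def graded_piece_zero_iff by auto

lemma inj_mult_iff:
  assumes "L \<in> hom_polys n 1"
  shows "inj_on (\<lambda>a. residue_class n I L \<otimes>\<^bsub>galg n I\<^esub> a) (graded_piece n I i) \<longleftrightarrow>
    (\<forall>p\<in>hom_polys n i. L * p \<in> I \<longrightarrow> p \<in> I)" (is "?inj \<longleftrightarrow> ?R")
proof -
  have L: "L \<in> carrier (mpol_ring n)" using assms by (rule hom_polys_carrier)
  have "?inj \<longleftrightarrow> (\<forall>p\<in>hom_polys n i. \<forall>q\<in>hom_polys n i.
      residue_class n I (L * p) = residue_class n I (L * q) \<longrightarrow>
      residue_class n I p = residue_class n I q)"
    unfolding inj_on_def graded_piece_def
    by (simp add: residue_mult[OF L] hom_polys_carrier)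
  also have "\<dots> \<longleftrightarrow> (\<forall>p\<in>hom_polys n i. \<forall>q\<in>hom_polys n i. L * (p - q) \<in> I \<longrightarrow> p - q \<in> I)"
    by (simp add: residue_eq_iff hom_polys_carrier carrier_mult[OF L] right_diff_distrib)
  also have "\<dots> \<longleftrightarrow> ?R"
  proof
    assume *: "\<forall>p\<in>hom_polys n i. \<forall>q\<in>hom_polys n i. L * (p - q) \<in> I \<longrightarrow> p - q \<in> I"
    show ?R
    proof
      fix p :: "'k mpol" assume "p \<in> hom_polys n i"
      then show "L * p \<in> I \<longrightarrow> p \<in> I"
        using *[rule_format, of p 0] by simp
    qed
  next
    assume *: ?R
    show "\<forall>p\<in>hom_polys n i. \<forall>q\<in>hom_polys n i. L * (p - q) \<in> I \<longrightarrow> p - q \<in> I"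
      using mp.subspace_diff[OF subspace_hom_polys] by (intro ballI *[THEN bspec]) blast
  qed
  finally show ?thesis .
qed

lemma surj_mult_iff:
  assumes "L \<in> hom_polys n 1"
  shows "(\<lambda>a. residue_class n I L \<otimes>\<^bsub>galg n I\<^esub> a) ` graded_piece n I i = graded_piece n I (i + 1) \<longleftrightarrow>
    (\<forall>b\<in>hom_polys n (i + 1). \<exists>p\<in>hom_polys n i. b - L * p \<in> I)" (is "?surj \<longleftrightarrow> ?R")
proof -
  have L: "L \<in> carrier (mpol_ring n)" using assms by (rule hom_polys_carrier)
  have Lp: "L * p \<in> hom_polys n (i + 1)" if "p \<in> hom_polys n i" for p
    using hom_polys_mult[OF assms that] by simp
  have img: "(\<lambda>a. residue_class n I L \<otimes>\<^bsub>galg n I\<^esub> a) ` graded_piece n I i =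
      (\<lambda>p. residue_class n I (L * p)) ` hom_polys n i"
    unfolding graded_piece_def image_image
    by (intro image_cong refl) (simp add: residue_mult[OF L] hom_polys_carrier)
  have "?surj \<longleftrightarrow> (\<forall>b\<in>hom_polys n (i + 1). \<exists>p\<in>hom_polys n i.
      residue_class n I b = residue_class n I (L * p))"
    unfolding img using Lp by (auto simp: graded_piece_def image_iff set_eq_iff)
  also have "\<dots> \<longleftrightarrow> ?R"
    by (simp add: residue_eq_iff hom_polys_carrier carrier_mult[OF L])
  finally show ?thesis .
qed

lemma weak_lefschetz_iff:
  "weak_lefschetz n I \<longleftrightarrow> (\<exists>L\<in>hom_polys n 1. \<forall>i.
    (\<forall>p\<in>hom_polys n i. L * p \<in> I \<longrightarrow> p \<in> I) \<or>
    (\<forall>b\<in>hom_polys n (i + 1). \<exists>p\<in>hom_polys n i. b - L * p \<in> I))"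
  unfolding weak_lefschetz_def graded_piece_def[of n I 1]
  by (simp add: inj_mult_iff surj_mult_iff del: One_nat_def)

end

section \<open>Dimensions over the ground field\<close>

lemma range_mpol_const_subfield: "subfield (range mpol_const) (mpol_ring n)"
proof -
  interpret R: cring "mpol_ring n :: 'a mpol ring" by (rule cring_mpol_ring)
  have sub: "subring (range (mpol_const :: 'a \<Rightarrow> _)) (mpol_ring n)"
  proof (rule R.subringI)
    show "range mpol_const \<subseteq> carrier (mpol_ring n)"
      using const_in_hom_polys hom_polys_carrier by blast
    show "\<one>\<^bsub>mpol_ring n\<^esub> \<in> range mpol_const"
      using const_coeff.hom_1 by (metis mpol_ring_simps(4) rangeI)
  next
    fix p assume "p \<in> range (mpol_const :: 'a \<Rightarrow> 'a mpol)"
    then obtain c where c: "p = mpol_const c" by blast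
    have "\<ominus>\<^bsub>mpol_ring n\<^esub> p = mpol_const (- c)"
      unfolding c
      by (intro R.sum_zero_eq_neg[symmetric] hom_polys_carrier[OF const_in_hom_polys])
        (simp_all add: mpol_ring_simps const_coeff.hom_add[symmetric] const_coeff.hom_0)
    then show "\<ominus>\<^bsub>mpol_ring n\<^esub> p \<in> range mpol_const" by simp
  qed (auto simp: mpol_ring_simps const_coeff.hom_add[symmetric] const_coeff.hom_mult[symmetric])
  show ?thesis
  proof (rule R.subfieldI)
    show "subcring (range mpol_const) (mpol_ring n :: 'a mpol ring)"
      by (rule R.subcringI'[OF sub])
    show "Units (mpol_ring n \<lparr>carrier := range (mpol_const :: 'a \<Rightarrow> _)\<rparr>) =
        range mpol_const - {\<zero>\<^bsub>mpol_ring n\<^esub>}"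
    proof (intro equalityI subsetI)
      fix p assume "p \<in> Units (mpol_ring n \<lparr>carrier := range (mpol_const :: 'a \<Rightarrow> _)\<rparr>)"
      then show "p \<in> range mpol_const - {\<zero>\<^bsub>mpol_ring n\<^esub>}"
        by (auto simp: Units_def mpol_ring_simps)
    next
      fix p assume "p \<in> range (mpol_const :: 'a \<Rightarrow> _) - {\<zero>\<^bsub>mpol_ring n\<^esub>}"
      then obtain c where c: "p = mpol_const c" "c \<noteq> 0"
        using const_coeff.hom_0 by (auto simp: mpol_ring_simps)
      have "mpol_const (inverse c) * p = 1" "p * mpol_const (inverse c) = 1"
        using c by (simp_all add: const_coeff.hom_mult[symmetric] const_coeff.hom_1)
      then show "p \<in> Units (mpol_ring n \<lparr>carrier := range (mpol_const :: 'a \<Rightarrow> _)\<rparr>)"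
        using c by (auto simp: Units_def mpol_ring_simps)
    qed
  qed
qed

text \<open>The inductive definition of \<open>dimension\<close> grows by one
  \<open>line_extension\<close> with a vector outside the current space. Adjoining
  \<open>g d\<close> is exactly such a step, because the span of the enlarged family consists of the
  elements \<open>cscale c (g d) + u\<close>.\<close>

lemma dimension_image_span:
  fixes h :: "'k::field mpol \<Rightarrow> 'b" and R :: "'b ring"
  assumes hom: "ring_hom_ring (mpol_ring n) R h"
    and g: "\<And>i. i < d \<Longrightarrow> g i \<in> carrier (mpol_ring n)"
    and new: "\<And>i. i < d \<Longrightarrow> h (g i) \<notin> h ` mp.span (g ` {..<i})"
  shows "ring.dimension R d (h ` range mpol_const) (h ` mp.span (g ` {..<d}))"
  using g new
proof (induction d)
  interpret H: ring_hom_ring "mpol_ring n" R h by (rule hom)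
  case 0
  have "h 0 = \<zero>\<^bsub>R\<^esub>" using H.hom_zero by (simp add: mpol_ring_simps)
  then show ?case using H.S.dimension.intros(1) by simp
next
  interpret H: ring_hom_ring "mpol_ring n" R h by (rule hom)
  case (Suc d)
  let ?E = "mp.span (g ` {..<d})"
  have E: "?E \<subseteq> carrier (mpol_ring n)"
    using Suc.prems(1) by (intro mp.span_minimal subspace_carrier) auto
  have gd: "g d \<in> carrier (mpol_ring n)" using Suc.prems(1) by simp
  have "h (g d) \<notin> h ` ?E" using Suc.prems(2) by simp
  moreover have "H.S.dimension d (h ` range mpol_const) (h ` ?E)"
    by (intro Suc.IH Suc.prems) simp_all
  ultimately have "H.S.dimension (Suc d) (h ` range mpol_const)
      (H.S.line_extension (h ` range mpol_const) (h (g d)) (h ` ?E))"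
    using gd by (intro H.S.dimension.intros(2)) auto
  moreover have "H.S.line_extension (h ` range mpol_const) (h (g d)) (h ` ?E) =
      h ` mp.span (g ` {..<Suc d})"
  proof -
    have hom_comb: "h (mpol_const c) \<otimes>\<^bsub>R\<^esub> h (g d) \<oplus>\<^bsub>R\<^esub> h u = h (cscale c (g d) + u)"
      if "u \<in> ?E" for c u
    proof -
      have "u \<in> carrier (mpol_ring n)" using that E by blast
      moreover have "mpol_const c \<in> carrier (mpol_ring n)"
        by (rule hom_polys_carrier[OF const_in_hom_polys])
      ultimately have "h (mpol_const c \<otimes>\<^bsub>mpol_ring n\<^esub> g d \<oplus>\<^bsub>mpol_ring n\<^esub> u) =
          h (mpol_const c) \<otimes>\<^bsub>R\<^esub> h (g d) \<oplus>\<^bsub>R\<^esub> h u"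
        using gd by (simp only: H.hom_add H.hom_mult H.R.m_closed)
      then show ?thesis by (simp add: mpol_ring_simps cscale_def)
    qed
    have span: "mp.span (g ` {..<Suc d}) = {cscale c (g d) + u | c u. u \<in> ?E}"
      unfolding lessThan_Suc image_insert mp.span_insert
    proof (intro equalityI subsetI)
      fix y assume "y \<in> {y. \<exists>c. y - cscale c (g d) \<in> ?E}"
      then obtain c where "y - cscale c (g d) \<in> ?E" by blast
      moreover have "y = cscale c (g d) + (y - cscale c (g d))" by simp
      ultimately show "y \<in> {cscale c (g d) + u | c u. u \<in> ?E}" by blast
    next
      fix y assume "y \<in> {cscale c (g d) + u | c u. u \<in> ?E}"
      then obtain c u where "u \<in> ?E" "y = cscale c (g d) + u" by blast
      then have "y - cscale c (g d) \<in> ?E" by simp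
      then show "y \<in> {y. \<exists>c. y - cscale c (g d) \<in> ?E}" by blast
    qed
    show ?thesis
      unfolding span
    proof (intro equalityI subsetI)
      fix y assume "y \<in> H.S.line_extension (h ` range mpol_const) (h (g d)) (h ` ?E)"
      then obtain c u where u: "u \<in> ?E"
        and y: "y = h (mpol_const c) \<otimes>\<^bsub>R\<^esub> h (g d) \<oplus>\<^bsub>R\<^esub> h u"
        unfolding H.S.line_extension_mem_iff by blast
      show "y \<in> h ` {cscale c (g d) + u | c u. u \<in> ?E}"
        unfolding y hom_comb[OF u] using u by blast
    next
      fix y assume "y \<in> h ` {cscale c (g d) + u | c u. u \<in> ?E}"
      then obtain c u where u: "u \<in> ?E" and y: "y = h (cscale c (g d) + u)" by blast
      show "y \<in> H.S.line_extension (h ` range mpol_const) (h (g d)) (h ` ?E)"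
        unfolding H.S.line_extension_mem_iff y hom_comb[OF u, symmetric] using u by blast
    qed
  qed
  ultimately show ?case by simp
qed

text \<open>The functional \<open>f i\<close> descends along \<open>h\<close>, kills the earlier
  vectors and is 1 on \<open>g i\<close>; hence the image of \<open>g i\<close> is new at each
  step.\<close>

lemma dimension_biorthogonal:
  fixes h :: "'k::field mpol \<Rightarrow> 'b" and R :: "'b ring"
  assumes hom: "ring_hom_ring (mpol_ring n) R h"
    and g: "\<And>i. i < d \<Longrightarrow> g i \<in> carrier (mpol_ring n)"
    and add: "\<And>i p q. i < d \<Longrightarrow> f i (p + q) = f i p + f i q"
    and sc: "\<And>i c p. i < d \<Longrightarrow> f i (cscale c p) = c * f i p"
    and ker: "\<And>i p q. i < d \<Longrightarrow> p \<in> carrier (mpol_ring n) \<Longrightarrow> q \<in> carrier (mpol_ring n) \<Longrightarrow>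
      h p = h q \<Longrightarrow> f i p = (f i q :: 'k)"
    and fg: "\<And>i j. i < d \<Longrightarrow> j < d \<Longrightarrow> f i (g j) = (if i = j then 1 else 0)"
  shows "ring.dimension R d (h ` range mpol_const) (h ` mp.span (g ` {..<d}))"
proof (rule dimension_image_span[OF hom g])
  fix i assume i: "i < d"
  have "f i 0 = 0" using sc[OF i, of 0 0] by simp
  then have "mp.subspace {u. f i u = 0}"
    using add[OF i] sc[OF i] by (auto simp: mp.subspace_def)
  then have fE: "mp.span (g ` {..<i}) \<subseteq> {u. f i u = 0}"
    using fg i by (intro mp.span_minimal) auto
  have E: "mp.span (g ` {..<i}) \<subseteq> carrier (mpol_ring n)"
    using g i by (intro mp.span_minimal subspace_carrier) auto
  show "h (g i) \<notin> h ` mp.span (g ` {..<i})"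
  proof
    assume "h (g i) \<in> h ` mp.span (g ` {..<i})"
    then obtain u where u: "u \<in> mp.span (g ` {..<i})" "h (g i) = h u" by blast
    then have "f i (g i) = f i u" using E by (intro ker i g) auto
    also have "f i u = 0" using u fE by auto
    finally show False using fg[OF i i] by simp
  qed
qed

context mpol_ideal
begin

lemma subfield_ground_field:
  assumes "1 \<notin> I"
  shows "subfield (ground_field n I) (galg n I)"
proof -
  interpret H: ring_hom_ring "mpol_ring n" "galg n I" "residue_class n I" by (rule residue_hom)
  have "residue_class n I 1 \<noteq> \<zero>\<^bsub>galg n I\<^esub>"
    using assms residue_zero_iff[OF hom_polys_carrier[OF one_in_hom_polys]] by simp
  then have "\<one>\<^bsub>galg n I\<^esub> \<noteq> \<zero>\<^bsub>galg n I\<^esub>"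
    using H.hom_one by (simp add: mpol_ring_simps)
  then show ?thesis
    unfolding ground_field_def by (rule H.img_is_subfield(2)[OF range_mpol_const_subfield])
qed

text \<open>When \<open>1 \<notin> I\<close> the image of \<open>k\<close> is a field, and over a
  field the dimension is unique.\<close>

lemma hvec_eqI:
  assumes "1 \<notin> I" "ring.dimension (galg n I) d (ground_field n I) (graded_piece n I i)"
  shows "hvec n I i = d"
  using ring.dimI[OF ring_galg subfield_ground_field[OF assms(1)] assms(2)]
  by (simp add: hvec_def over_def)

lemma residue_image_eqI:
  assumes "U \<subseteq> V" "V \<subseteq> carrier (mpol_ring n)" "\<And>v. v \<in> V \<Longrightarrow> \<exists>u\<in>U. v - u \<in> I"
  shows "residue_class n I ` U = residue_class n I ` V"
proof (intro equalityI image_subsetI)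
  show "residue_class n I u \<in> residue_class n I ` V" if "u \<in> U" for u
    using assms(1) that by blast
  fix v assume v: "v \<in> V"
  then obtain u where u: "u \<in> U" "v - u \<in> I" using assms(3) by blast
  then have "residue_class n I v = residue_class n I u"
    using v assms(1,2) by (subst residue_eq_iff) auto
  then show "residue_class n I v \<in> residue_class n I ` U" using u by simp
qed

lemma socle_eq:
  "socle n I = residue_class n I ` {p \<in> carrier (mpol_ring n). \<forall>j<n. mpol_var j * p \<in> I}"
proof -
  have "residue_class n I p \<otimes>\<^bsub>galg n I\<^esub> residue_class n I (mpol_var j) = \<zero>\<^bsub>galg n I\<^esub> \<longleftrightarrow>
      mpol_var j * p \<in> I" if "p \<in> carrier (mpol_ring n)" "j < n" for p j
  proof -
    have x: "mpol_var j \<in> carrier (mpol_ring n)"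
      by (rule hom_polys_carrier[OF var_in_hom_polys[OF that(2)]])
    show ?thesis
      by (simp only: residue_mult[OF that(1) x] residue_zero_iff[OF carrier_mult[OF that(1) x]])
        (simp add: mult.commute)
  qed
  then show ?thesis
    unfolding socle_def carrier_galg by blast
qed

end

text \<open>The map \<open>h\<close> is kept general for two uses: the identity gives the dimension
  of the space of forms itself, the residue map gives the \<open>h\<close>-vector in degrees where
  the ideal has no nonzero form.\<close>

lemma dimension_hom_polys_image:
  fixes h :: "'k::field mpol \<Rightarrow> 'b" and R :: "'b ring"
  assumes hom: "ring_hom_ring (mpol_ring n) R h"
    and inj: "inj_on h (hom_polys n i)"
  shows "ring.dimension R (card (monoms n i)) (h ` range mpol_const) (h ` hom_polys n i)"
proof -
  obtain b where b: "bij_betw b {..<card (monoms n i)} (monoms n i)"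
    using ex_bij_betw_nat_finite[OF finite_monoms, of n i] by (auto simp: atLeast0LessThan)
  let ?g = "\<lambda>j. Poly_Mapping.single (b j) (1::'k)"
  have b_mem: "b j \<in> monoms n i" if "j < card (monoms n i)" for j
    using bij_betwE[OF b] that by blast
  have g_mem: "?g j \<in> hom_polys n i" if "j < card (monoms n i)" for j
    by (rule single_in_hom_polys[OF b_mem[OF that]])
  have "ring.dimension R (card (monoms n i)) (h ` range mpol_const)
      (h ` mp.span (?g ` {..<card (monoms n i)}))"
  proof (rule dimension_image_span[OF hom hom_polys_carrier[OF g_mem]])
    fix j assume j: "j < card (monoms n i)"
    have "mp.subspace {u. Poly_Mapping.lookup u (b j) = (0::'k)}"
      by (auto simp: mp.subspace_def lookup_add)
    then have coeff: "mp.span (?g ` {..<j}) \<subseteq> {u. Poly_Mapping.lookup u (b j) = 0}"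
      using bij_betw_imp_inj_on[OF b] j
      by (intro mp.span_minimal) (auto simp: lookup_single when_def inj_on_eq_iff)
    have sub: "mp.span (?g ` {..<j}) \<subseteq> hom_polys n i"
      using g_mem j by (intro mp.span_minimal subspace_hom_polys) auto
    show "h (?g j) \<notin> h ` mp.span (?g ` {..<j})"
    proof
      assume "h (?g j) \<in> h ` mp.span (?g ` {..<j})"
      then have "?g j \<in> mp.span (?g ` {..<j})"
        using inj_onD[OF inj _ g_mem[OF j]] sub by blast
      then show False using coeff by auto
    qed
  qed
  moreover have "?g ` {..<card (monoms n i)} =
      (\<lambda>m. Poly_Mapping.single m 1) ` b ` {..<card (monoms n i)}"
    by (simp only: image_image)
  then have "mp.span (?g ` {..<card (monoms n i)}) = hom_polys n i"
    by (simp only: bij_betw_imp_surj_on[OF b] hom_polys_eq_span)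
  ultimately show ?thesis by simp
qed

lemma dim_hom_polys_eq: "dim_hom_polys TYPE('k::field) n i = card (monoms n i)"
proof -
  interpret R: cring "mpol_ring n :: 'k mpol ring" by (rule cring_mpol_ring)
  have "ring_hom_ring (mpol_ring n) (mpol_ring n :: 'k mpol ring) id"
    by (intro ring_hom_ringI2 R.ring_axioms) (auto simp: ring_hom_def)
  from dimension_hom_polys_image[OF this, of i]
  have "R.dimension (card (monoms n i)) (range mpol_const) (hom_polys n i)" by simp
  then show ?thesis
    unfolding dim_hom_polys_def
    using R.dimI[OF range_mpol_const_subfield] by (simp add: over_def)
qed

lemma (in mpol_ideal) hvec_eq_card_monoms:
  assumes "1 \<notin> I" "\<And>p. p \<in> hom_polys n i \<Longrightarrow> p \<in> I \<Longrightarrow> p = 0"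
  shows "hvec n I i = card (monoms n i)"
proof (rule hvec_eqI[OF assms(1)])
  have "inj_on (residue_class n I) (hom_polys n i)"
  proof (rule inj_onI)
    fix p q assume p: "p \<in> hom_polys n i" and q: "q \<in> hom_polys n i"
      and "residue_class n I p = residue_class n I q"
    then have "p - q \<in> I"
      using residue_eq_iff[OF hom_polys_carrier[OF p] hom_polys_carrier[OF q]] by simp
    then have "p - q = 0"
      by (intro assms(2) mp.subspace_diff[OF subspace_hom_polys p q])
    then show "p = q" by simp
  qed
  then show "ring.dimension (galg n I) (card (monoms n i)) (ground_field n I) (graded_piece n I i)"
    unfolding ground_field_def graded_piece_def by (rule dimension_hom_polys_image[OF residue_hom])
qed

section \<open>Algebras with a dual functional\<close>

text \<open>A functional on the forms of degree \<open>e\<close>, that is a degree-\<open>e\<close>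
  element of the inverse system, is extended by zero to the other degrees. Then
  \<open>\<phi> (p * q)\<close> is meaningful for all polynomials.\<close>

locale form_functional =
  fixes n e :: nat and \<phi> :: "'k::field mpol \<Rightarrow> 'k"
  assumes add: "\<phi> (p + q) = \<phi> p + \<phi> q"
    and scale: "\<phi> (cscale c p) = c * \<phi> p"
    and other_degree: "p \<in> hom_polys n i \<Longrightarrow> i \<noteq> e \<Longrightarrow> \<phi> p = 0"
begin

lemma zero: "\<phi> 0 = 0"
  using scale[of 0 0] by simp

lemma diff: "\<phi> (p - q) = \<phi> p - \<phi> q"
  using add[of "p - q" q] by simp

lemma sum: "\<phi> (sum f A) = (\<Sum>i\<in>A. \<phi> (f i))"
  by (induction A rule: infinite_finite_induct) (simp_all add: zero add)

lemma eq_hom_comp: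
  assumes "p \<in> carrier (mpol_ring n)"
  shows "\<phi> p = \<phi> (hom_comp e p)"
  using assms
proof (induction rule: carrier_induct)
  case subspace
  show ?case by (auto simp: mp.subspace_def hom_comp_add hom_comp_cscale hom_comp_0 add scale)
next
  case (homogeneous q i)
  then show ?case
    using other_degree[OF homogeneous] by (simp add: hom_comp_hom_polys zero)
qed

text \<open>Residuals with respect to either half of a biorthogonal system expand to the same double
  sum, so a residual can be moved to the other side of the pairing.\<close>

lemma mult_residual:
  "\<phi> ((v - (\<Sum>j<d. cscale (k j) (g j))) * w) = \<phi> (v * w) - (\<Sum>j<d. k j * \<phi> (g j * w))"
  by (simp add: left_diff_distrib sum_distrib_right diff sum cscale_mult_left scale)

lemma subspace_kernel: "mp.subspace {q. \<phi> (p * q) = 0}"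
  by (auto simp: mp.subspace_def distrib_left add zero cscale_mult_right scale)

end

text \<open>Macaulay's correspondence: these conditions determine the ideal from \<phi> and make the
  pairing of A_i with A_{e-i} perfect.\<close>

locale macaulay_dual = form_functional n e \<phi> + mpol_ideal n I
  for n e and \<phi> :: "'k::field mpol \<Rightarrow> 'k" and I +
  assumes homogeneous: "p \<in> I \<Longrightarrow> hom_comp d p \<in> I"
    and nonzero: "\<exists>u\<in>hom_polys n e. \<phi> u \<noteq> 0"
    and mem_iff: "p \<in> hom_polys n i \<Longrightarrow> i \<le> e \<Longrightarrow>
      p \<in> I \<longleftrightarrow> (\<forall>q\<in>hom_polys n (e - i). \<phi> (p * q) = 0)"
    and above: "p \<in> hom_polys n i \<Longrightarrow> e < i \<Longrightarrow> p \<in> I"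
begin

lemma vanish:
  assumes "p \<in> I"
  shows "\<phi> p = 0"
proof -
  have "hom_comp e p \<in> hom_polys n e" by (rule hom_comp_in_hom_polys[OF mem_carrier[OF assms]])
  then have "\<phi> (hom_comp e p * 1) = 0"
    using homogeneous[OF assms, of e] mem_iff[of _ e] one_in_hom_polys[of n] by auto
  then show ?thesis using eq_hom_comp[OF mem_carrier[OF assms]] by simp
qed

lemma vanish_mult: "p \<in> I \<Longrightarrow> q \<in> carrier (mpol_ring n) \<Longrightarrow> \<phi> (p * q) = 0"
  by (intro vanish mult_mem')

lemma socle_degree: "has_socle_degree n I e"
  unfolding has_socle_degree_iff using nonzero vanish above by blast

lemma one_notin: "1 \<notin> I"
proof
  assume "1 \<in> I"
  then have "p \<in> I" if "p \<in> carrier (mpol_ring n)" for p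
    using mult_mem[OF _ that] by fastforce
  then show False using nonzero vanish hom_polys_carrier by blast
qed

text \<open>A maximal biorthogonal system for the pairing between degrees \<open>i\<close> and
  \<open>e - i\<close> gives bases of both graded pieces at once; the equality of their dimensions
  is the symmetry of the \<open>h\<close>-vector.\<close>

lemma dual_bases:
  assumes "i \<le> e"
  obtains d :: nat and g x where
    "\<And>j. j < d \<Longrightarrow> g j \<in> hom_polys n i" "\<And>j. j < d \<Longrightarrow> x j \<in> hom_polys n (e - i)"
    "\<And>v. v \<in> hom_polys n i \<Longrightarrow> v - (\<Sum>j<d. cscale (\<phi> (v * x j)) (g j)) \<in> I"
    "hvec n I i = d" "hvec n I (e - i) = d"
proof -
  obtain d :: nat and g x :: "nat \<Rightarrow> 'k mpol" where
    g: "\<And>j. j < d \<Longrightarrow> g j \<in> hom_polys n i" and x: "\<And>j. j < d \<Longrightarrow> x j \<in> hom_polys n (e - i)" and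
    gx: "\<And>j l. j < d \<Longrightarrow> l < d \<Longrightarrow> \<phi> (g l * x j) = (if j = l then 1 else 0)" and
    res: "\<And>v y. v \<in> hom_polys n i \<Longrightarrow> y \<in> hom_polys n (e - i) \<Longrightarrow>
      \<phi> ((v - (\<Sum>j<d. cscale (\<phi> (v * x j)) (g j))) * y) = 0"
    by (rule mp.biorthogonal_system[where V = "hom_polys n i" and X = "hom_polys n (e - i)"
          and f = "\<lambda>q p. \<phi> (p * q)" and B = "(\<lambda>m. Poly_Mapping.single m 1) ` monoms n i"])
      (auto simp: subspace_hom_polys finite_monoms hom_polys_eq_span[symmetric] distrib_right add
        cscale_mult_left scale)
  have sum_mem: "(\<Sum>j<d. cscale (\<phi> (v * x j)) (g j)) \<in> mp.span (g ` {..<d})" for v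
    by (intro mp.span_sum mp.span_scale mp.span_base) auto
  have span_g: "mp.span (g ` {..<d}) \<subseteq> hom_polys n i"
    using g by (intro mp.span_minimal subspace_hom_polys) auto
  have 1: "v - (\<Sum>j<d. cscale (\<phi> (v * x j)) (g j)) \<in> I" if "v \<in> hom_polys n i" for v
    using that sum_mem span_g res assms
    by (subst mem_iff[of _ i]) (auto intro!: mp.subspace_diff subspace_hom_polys)
  have span_x: "mp.span (x ` {..<d}) \<subseteq> hom_polys n (e - i)"
    using x by (intro mp.span_minimal subspace_hom_polys) auto
  have sum_mem': "(\<Sum>j<d. cscale (\<phi> (w * g j)) (x j)) \<in> mp.span (x ` {..<d})" for w
    by (intro mp.span_sum mp.span_scale mp.span_base) auto
  \<comment> \<open>Maximality controls residuals in degree \<open>i\<close>. The residual of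
    \<open>w\<close> tested on \<open>v\<close> is the same number as the residual of
    \<open>v\<close> tested on \<open>w\<close>, which settles degree \<open>e - i\<close>.\<close>
  have 2: "w - (\<Sum>j<d. cscale (\<phi> (w * g j)) (x j)) \<in> I" if w: "w \<in> hom_polys n (e - i)" for w
  proof (subst mem_iff[of _ "e - i"])
    show "w - (\<Sum>j<d. cscale (\<phi> (w * g j)) (x j)) \<in> hom_polys n (e - i)"
      using w sum_mem' span_x by (auto intro!: mp.subspace_diff subspace_hom_polys)
    show "\<forall>v\<in>hom_polys n (e - (e - i)). \<phi> ((w - (\<Sum>j<d. cscale (\<phi> (w * g j)) (x j))) * v) = 0"
    proof
      fix v :: "'k mpol" assume "v \<in> hom_polys n (e - (e - i))"
      then have v: "v \<in> hom_polys n i" using assms by simp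
      have "\<phi> ((w - (\<Sum>j<d. cscale (\<phi> (w * g j)) (x j))) * v) =
          \<phi> (w * v) - (\<Sum>j<d. \<phi> (w * g j) * \<phi> (x j * v))"
        by (rule mult_residual)
      also have "\<dots> = \<phi> ((v - (\<Sum>j<d. cscale (\<phi> (v * x j)) (g j))) * w)"
        unfolding mult_residual by (simp add: mult.commute)
      also have "\<dots> = 0" using res[OF v w] .
      finally show "\<phi> ((w - (\<Sum>j<d. cscale (\<phi> (w * g j)) (x j))) * v) = 0" .
    qed
  qed simp
  have ker: "\<phi> (p * y) = \<phi> (q * y)"
    if "p \<in> carrier (mpol_ring n)" "q \<in> carrier (mpol_ring n)" "y \<in> carrier (mpol_ring n)"
      "residue_class n I p = residue_class n I q" for p q y
    using that residue_eq_iff[of p q] vanish_mult[of "p - q" y] by (simp add: left_diff_distrib diff)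
  note carriers = hom_polys_carrier[OF g] hom_polys_carrier[OF x]
  have "ring.dimension (galg n I) d (ground_field n I) (residue_class n I ` mp.span (g ` {..<d}))"
    unfolding ground_field_def
  proof (rule dimension_biorthogonal[OF residue_hom, where f = "\<lambda>j p. \<phi> (p * x j)"])
    show "\<phi> (p * x j) = \<phi> (q * x j)"
      if "j < d" "p \<in> carrier (mpol_ring n)" "q \<in> carrier (mpol_ring n)"
        "residue_class n I p = residue_class n I q" for j p q
      by (rule ker[OF that(2,3) carriers(2)[OF that(1)] that(4)])
  qed (use gx carriers in \<open>simp_all add: distrib_right add cscale_mult_left scale\<close>)
  moreover have "residue_class n I ` mp.span (g ` {..<d}) = graded_piece n I i"
    unfolding graded_piece_def
    by (rule residue_image_eqI[OF span_g]) (use 1 sum_mem hom_polys_carrier in blast)+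
  ultimately have 3: "hvec n I i = d" by (intro hvec_eqI one_notin) simp
  have "ring.dimension (galg n I) d (ground_field n I) (residue_class n I ` mp.span (x ` {..<d}))"
    unfolding ground_field_def
  proof (rule dimension_biorthogonal[OF residue_hom, where f = "\<lambda>j p. \<phi> (p * g j)"])
    show "\<phi> (p * g j) = \<phi> (q * g j)"
      if "j < d" "p \<in> carrier (mpol_ring n)" "q \<in> carrier (mpol_ring n)"
        "residue_class n I p = residue_class n I q" for j p q
      by (rule ker[OF that(2,3) carriers(1)[OF that(1)] that(4)])
  qed (use gx carriers in \<open>simp_all add: distrib_right add cscale_mult_left scale
        mult.commute[of "x _"]\<close>)
  moreover have "residue_class n I ` mp.span (x ` {..<d}) = graded_piece n I (e - i)"
    unfolding graded_piece_def
    by (rule residue_image_eqI[OF span_x]) (use 2 sum_mem' hom_polys_carrier in blast)+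
  ultimately have 4: "hvec n I (e - i) = d" by (intro hvec_eqI one_notin) simp
  show ?thesis
    by (rule that[of d g x]) (use g x 1 3 4 in auto)
qed

lemma hvec_symmetric: "i \<le> e \<Longrightarrow> hvec n I (e - i) = hvec n I i"
  by (erule dual_bases) simp

text \<open>There is no socle below degree \<open>e\<close>: a test form of positive degree is a
  combination of products \<open>x_j q\<close>, and the variable can be moved over to
  \<open>p\<close>.\<close>

lemma var_mult_mem:
  assumes "p \<in> hom_polys n i" "i < e" "\<And>j. j < n \<Longrightarrow> mpol_var j * p \<in> I"
  shows "p \<in> I"
proof (subst mem_iff[OF assms(1)])
  show "\<forall>q\<in>hom_polys n (e - i). \<phi> (p * q) = 0"
  proof
    fix q :: "'k mpol" assume "q \<in> hom_polys n (e - i)"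
    then have "q \<in> hom_polys n (Suc (e - Suc i))" using assms(2) by (simp add: Suc_diff_Suc)
    then show "\<phi> (p * q) = 0"
    proof (induction rule: hom_polys_Suc_induct)
      case subspace
      show ?case by (rule subspace_kernel)
    next
      case (var j q)
      have "p * (mpol_var j * q) = (mpol_var j * p) * q" by (simp add: ac_simps)
      then show ?case using vanish_mult[OF assms(3)[OF var(1)]] var(2) hom_polys_carrier by metis
    qed
  qed
qed (use assms in simp)

text \<open>If \<open>L\<close> kills \<open>p\<close>, it kills every \<open>x_j p\<close> one
  degree higher; by induction all these are zero in the algebra, so \<open>p\<close> is a socle
  element of degree below \<open>e\<close> and hence zero.\<close>

lemma inj_downward:
  assumes L: "L \<in> hom_polys n 1" and "i \<le> m" "m < e"
    and "\<And>p. p \<in> hom_polys n m \<Longrightarrow> L * p \<in> I \<Longrightarrow> p \<in> I"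
    and "p \<in> hom_polys n i" "L * p \<in> I"
  shows "p \<in> I"
  using assms(2,5,6)
proof (induction i arbitrary: p rule: inc_induct)
  case base
  then show ?case using assms(4) by blast
next
  case (step i)
  show ?case
  proof (rule var_mult_mem[OF step.prems(1)])
    show "i < e" using step.hyps assms(3) by simp
    fix j assume j: "j < n"
    have x: "mpol_var j \<in> hom_polys n 1" by (rule var_in_hom_polys[OF j])
    show "mpol_var j * p \<in> I"
    proof (rule step.IH)
      show "mpol_var j * p \<in> hom_polys n (Suc i)" using hom_polys_mult[OF x step.prems(1)] by simp
      show "L * (mpol_var j * p) \<in> I"
        using mult_mem[OF step.prems(2) hom_polys_carrier[OF x]] by (simp add: ac_simps)
    qed
  qed
qed

text \<open>Under the pairing $(p, q) \mapsto \varphi(pq)$ the multiplication $A_i \to A_{i+1}$ by \<open>L\<close> is the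
  transpose of the one $A_{e-i-1} \to A_{e-i}$.\<close>

lemma surj_of_inj:
  assumes L: "L \<in> hom_polys n 1" and "i < e"
    and inj: "\<And>p. p \<in> hom_polys n (e - Suc i) \<Longrightarrow> L * p \<in> I \<Longrightarrow> p \<in> I"
    and b: "b \<in> hom_polys n (i + 1)"
  shows "\<exists>p\<in>hom_polys n i. b - L * p \<in> I"
proof -
  let ?V = "hom_polys n (e - Suc i)"
  obtain d :: nat and g a :: "nat \<Rightarrow> 'k mpol" where
    g: "\<And>j. j < d \<Longrightarrow> g j \<in> ?V" and a: "\<And>j. j < d \<Longrightarrow> a j \<in> hom_polys n i" and
    "\<And>j l. j < d \<Longrightarrow> l < d \<Longrightarrow> \<phi> (L * g l * a j) = (if j = l then 1 else 0)" and
    res: "\<And>c y. c \<in> ?V \<Longrightarrow> y \<in> hom_polys n i \<Longrightarrow>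
      \<phi> (L * (c - (\<Sum>j<d. cscale (\<phi> (L * c * a j)) (g j))) * y) = 0"
    by (rule mp.biorthogonal_system[where V = ?V and X = "hom_polys n i"
          and f = "\<lambda>q p. \<phi> (L * p * q)" and B = "(\<lambda>m. Poly_Mapping.single m 1) ` monoms n (e - Suc i)"])
      (auto simp: subspace_hom_polys finite_monoms hom_polys_eq_span[symmetric] distrib_right
        distrib_left add cscale_mult_left cscale_mult_right scale)
  \<comment> \<open>The goal is \<open>\<phi> (L * p * c) = \<phi> (b * c)\<close> for all
    \<open>c\<close>. These coefficients are forced on \<open>c = g l\<close> by biorthogonality.
    The residual of a general \<open>c\<close> is killed by \<open>L\<close> in the algebra, so by
    injectivity it lies in \<open>I\<close>, where \<phi>(b .) vanishes.\<close>
  define p where "p = (\<Sum>j<d. cscale (\<phi> (b * g j)) (a j))"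
  have p: "p \<in> hom_polys n i"
    unfolding p_def using a by (intro mp.subspace_sum mp.subspace_scale subspace_hom_polys) auto
  have Lp_eq: "L * p = (\<Sum>j<d. cscale (\<phi> (b * g j)) (L * a j))"
    by (simp add: p_def sum_distrib_left cscale_mult_right)
  have "b - L * p \<in> I"
  proof (subst mem_iff[of _ "i + 1"])
    have Lp: "L * p \<in> hom_polys n (i + 1)" using hom_polys_mult[OF L p] by simp
    then show "b - L * p \<in> hom_polys n (i + 1)" by (rule mp.subspace_diff[OF subspace_hom_polys b])
    show "\<forall>q\<in>hom_polys n (e - (i + 1)). \<phi> ((b - L * p) * q) = 0"
    proof
      fix c :: "'k mpol" assume "c \<in> hom_polys n (e - (i + 1))"
      then have c: "c \<in> ?V" by simp
      let ?r = "c - (\<Sum>j<d. cscale (\<phi> (L * c * a j)) (g j))"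
      have r: "?r \<in> ?V"
        using c g by (intro mp.subspace_diff mp.subspace_sum mp.subspace_scale subspace_hom_polys) auto
      then have Lr: "L * ?r \<in> hom_polys n (e - i)"
        using hom_polys_mult[OF L r] assms(2) by (simp add: Suc_diff_Suc)
      have "L * ?r \<in> I"
        using res[OF c] assms(2) by (subst mem_iff[OF Lr]) auto
      then have "?r \<in> I" using inj[OF r] by blast
      then have "0 = \<phi> (?r * b)" using vanish_mult hom_polys_carrier[OF b] by simp
      also have "\<dots> = \<phi> (b * c) - (\<Sum>j<d. \<phi> (L * c * a j) * \<phi> (b * g j))"
        unfolding mult_residual by (simp add: mult.commute)
      also have "\<dots> = \<phi> ((b - L * p) * c)"
        unfolding Lp_eq mult_residual by (simp add: ac_simps)
      finally show "\<phi> ((b - L * p) * c) = 0" by simp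
    qed
  qed (use assms(2) in simp)
  then show ?thesis using p by blast
qed

text \<open>One degree decides: injectivity descends from \<open>m\<close>; for
  \<open>m < i < e\<close> the transposed map starts in degree \<open>e - i - 1\<close>, which is at
  most \<open>m\<close> for either parity; from degree \<open>e\<close> on the target is
  zero.\<close>

lemma weak_lefschetzI:
  assumes "L \<in> hom_polys n 1" "e = 2 * m + 1 \<or> e = 2 * m + 2"
    and inj: "\<And>p. p \<in> hom_polys n m \<Longrightarrow> L * p \<in> I \<Longrightarrow> p \<in> I"
  shows "weak_lefschetz n I"
  unfolding weak_lefschetz_iff
proof (intro bexI[OF _ assms(1)] allI)
  fix i
  have low: "p \<in> I" if "i \<le> m" "p \<in> hom_polys n i" "L * p \<in> I" for i p
    by (rule inj_downward[OF assms(1) that(1) _ inj that(2,3)]) (use assms(2) in auto)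
  consider "i \<le> m" | "m < i" "i < e" | "e \<le> i" by linarith
  then show "(\<forall>p\<in>hom_polys n i. L * p \<in> I \<longrightarrow> p \<in> I) \<or>
    (\<forall>b\<in>hom_polys n (i + 1). \<exists>p\<in>hom_polys n i. b - L * p \<in> I)"
  proof cases
    case 1
    then show ?thesis using low by blast
  next
    case 2
    then have "e - Suc i \<le> m" using assms(2) by auto
    then show ?thesis
      using surj_of_inj[OF assms(1) 2(2)] low by blast
  next
    case 3
    have "b - L * 0 \<in> I" if "b \<in> hom_polys n (i + 1)" for b
      using above[OF that] 3 by simp
    then show ?thesis using zero_in_hom_polys by blast
  qed
qed

text \<open>For \<open>e = 2 * m + 1\<close> the map from degree \<open>m\<close> to
  \<open>m + 1\<close> is its own transpose. If it is surjective, every test form \<open>q\<close>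
  is \<open>L * c\<close> modulo \<open>I\<close>, and \<open>L * p \<in> I\<close> then makes
  \<open>p\<close> pair to zero with \<open>q\<close>.\<close>

lemma weak_lefschetzE:
  assumes "weak_lefschetz n I" "e = 2 * m + 1"
  obtains L where "L \<in> hom_polys n 1" "\<And>p. p \<in> hom_polys n m \<Longrightarrow> L * p \<in> I \<Longrightarrow> p \<in> I"
proof -
  obtain L where L: "L \<in> hom_polys n 1" and
    *: "(\<forall>p\<in>hom_polys n m. L * p \<in> I \<longrightarrow> p \<in> I) \<or>
      (\<forall>b\<in>hom_polys n (m + 1). \<exists>p\<in>hom_polys n m. b - L * p \<in> I)"
    using assms(1) unfolding weak_lefschetz_iff by blast
  have "p \<in> I" if p: "p \<in> hom_polys n m" "L * p \<in> I" for p
    using *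
  proof
    assume surj: "\<forall>b\<in>hom_polys n (m + 1). \<exists>p\<in>hom_polys n m. b - L * p \<in> I"
    show "p \<in> I"
    proof (subst mem_iff[OF p(1)])
      show "\<forall>q\<in>hom_polys n (e - m). \<phi> (p * q) = 0"
      proof
        fix q :: "'k mpol" assume "q \<in> hom_polys n (e - m)"
        then have "q \<in> hom_polys n (m + 1)" using assms(2) by (simp add: mult_2)
        then obtain c where c: "c \<in> hom_polys n m" "q - L * c \<in> I" using surj by blast
        have "p * q = (L * p) * c + (q - L * c) * p" by (simp add: algebra_simps)
        then show "\<phi> (p * q) = 0"
          using vanish_mult[OF p(2) hom_polys_carrier[OF c(1)]]
            vanish_mult[OF c(2) hom_polys_carrier[OF p(1)]] by (simp add: add)
      qed
    qed (use assms(2) in simp)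
  qed (use p in blast)
  then show ?thesis using that L by blast
qed

end

text \<open>The largest ideal contained in the kernel of \<phi>. Testing against all polynomials
  makes the ideal property immediate; since \<phi> sees only degree \<open>e\<close>, a form need
  only be tested in the complementary degree.\<close>

definition annihilator :: "nat \<Rightarrow> ('k::field mpol \<Rightarrow> 'k) \<Rightarrow> 'k mpol set" where
  "annihilator n \<phi> = {p \<in> carrier (mpol_ring n). \<forall>q\<in>carrier (mpol_ring n). \<phi> (p * q) = 0}"

context form_functional
begin

lemma ideal_annihilator: "ideal (annihilator n \<phi>) (mpol_ring n)"
proof -
  interpret R: cring "mpol_ring n :: 'k mpol ring" by (rule cring_mpol_ring)
  have uminus: "\<ominus>\<^bsub>mpol_ring n\<^esub> p = - p" if "p \<in> carrier (mpol_ring n)" for p :: "'k mpol"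
    using mpol_ring_minus[OF R.zero_closed that] that by (simp add: R.minus_eq mpol_ring_simps(3,5))
  have neg: "\<phi> (- p) = - \<phi> p" for p
    using diff[of 0 p] by (simp add: zero)
  show ?thesis
  proof (rule idealI[OF R.ring_axioms])
    show "subgroup (annihilator n \<phi>) (add_monoid (mpol_ring n))"
    proof (rule R.add.subgroupI)
      show "annihilator n \<phi> \<subseteq> carrier (mpol_ring n)" by (auto simp: annihilator_def)
      have "0 \<in> annihilator n \<phi>"
        using R.zero_closed by (simp add: annihilator_def zero mpol_ring_simps(5))
      then show "annihilator n \<phi> \<noteq> {}" by blast
    next
      fix p assume p: "p \<in> annihilator n \<phi>"
      then have "p \<in> carrier (mpol_ring n)" by (simp add: annihilator_def)
      then show "\<ominus>\<^bsub>mpol_ring n\<^esub> p \<in> annihilator n \<phi>"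
        using p R.a_inv_closed[of p] by (simp add: uminus annihilator_def neg)
    next
      fix p q assume "p \<in> annihilator n \<phi>" "q \<in> annihilator n \<phi>"
      then show "p \<oplus>\<^bsub>mpol_ring n\<^esub> q \<in> annihilator n \<phi>"
        using R.a_closed[of p q] by (simp add: annihilator_def mpol_ring_simps(3) distrib_right add)
    qed
    fix p r :: "'k mpol" assume p: "p \<in> annihilator n \<phi>" and r: "r \<in> carrier (mpol_ring n)"
    have "p * r \<in> annihilator n \<phi>"
      using p r by (simp add: annihilator_def carrier_mult mult.assoc)
    then show "r \<otimes>\<^bsub>mpol_ring n\<^esub> p \<in> annihilator n \<phi>" "p \<otimes>\<^bsub>mpol_ring n\<^esub> r \<in> annihilator n \<phi>"
      by (simp_all only: mpol_ring_simps(2) mult.commute[of r])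
  qed
qed

lemma annihilator_iff:
  assumes p: "p \<in> hom_polys n i" and "i \<le> e"
  shows "p \<in> annihilator n \<phi> \<longleftrightarrow> (\<forall>q\<in>hom_polys n (e - i). \<phi> (p * q) = 0)"
proof
  assume *: "\<forall>q\<in>hom_polys n (e - i). \<phi> (p * q) = 0"
  have "\<phi> (p * q) = 0" if "q \<in> carrier (mpol_ring n)" for q
    using that
  proof (induction rule: carrier_induct)
    case subspace
    show ?case by (rule subspace_kernel)
  next
    case (homogeneous q j)
    show ?case
    proof (cases "j = e - i")
      case False
      then show ?thesis
        using other_degree[OF hom_polys_mult[OF p homogeneous]] assms(2) by auto
    qed (use * homogeneous in blast)
  qed
  then show "p \<in> annihilator n \<phi>"
    using p hom_polys_carrier by (auto simp: annihilator_def)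
qed (use hom_polys_carrier in \<open>auto simp: annihilator_def\<close>)

lemma annihilator_above:
  assumes p: "p \<in> hom_polys n i" and "e < i"
  shows "p \<in> annihilator n \<phi>"
proof -
  have "\<phi> (p * q) = 0" if "q \<in> carrier (mpol_ring n)" for q
    using that
  proof (induction rule: carrier_induct)
    case subspace
    show ?case by (rule subspace_kernel)
  next
    case (homogeneous q j)
    then show ?case
      using other_degree[OF hom_polys_mult[OF p homogeneous]] assms(2) by auto
  qed
  then show ?thesis
    using p hom_polys_carrier by (auto simp: annihilator_def)
qed

text \<open>Against a form of degree \<open>e - d\<close>, only the degree-\<open>d\<close>
  component of \<open>p\<close> produces something of degree \<open>e\<close>, so \<phi> cannot
  distinguish \<open>p\<close> from that component.\<close>

lemma annihilator_homogeneous: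
  assumes p: "p \<in> annihilator n \<phi>"
  shows "hom_comp d p \<in> annihilator n \<phi>"
proof (cases "d \<le> e")
  case True
  have pc: "p \<in> carrier (mpol_ring n)" using p by (simp add: annihilator_def)
  have split: "\<phi> (hom_comp d p * q) = \<phi> (p * q)" if q: "q \<in> hom_polys n (e - d)" for q
    using pc
  proof (induction rule: carrier_induct)
    case subspace
    show ?case
      by (auto simp: mp.subspace_def hom_comp_add hom_comp_cscale hom_comp_0 distrib_right add
          cscale_mult_left scale zero)
  next
    case (homogeneous r i)
    show ?case
    proof (cases "d = i")
      case False
      then have "\<phi> (r * q) = 0"
        using other_degree[OF hom_polys_mult[OF homogeneous q]] True by auto
      then show ?thesis using False by (simp add: hom_comp_hom_polys[OF homogeneous] zero)
    qed (simp add: hom_comp_hom_polys[OF homogeneous])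
  qed
  then show ?thesis
    using p
    by (subst annihilator_iff[OF hom_comp_in_hom_polys[OF pc] True])
      (auto simp: annihilator_def dest: hom_polys_carrier)
next
  case False
  then show ?thesis
    using p by (intro annihilator_above[OF hom_comp_in_hom_polys]) (auto simp: annihilator_def)
qed

lemma macaulay_dual_annihilator:
  assumes "\<exists>u\<in>hom_polys n e. \<phi> u \<noteq> 0"
  shows "macaulay_dual n e \<phi> (annihilator n \<phi>)"
  by (intro macaulay_dual.intro mpol_ideal.intro macaulay_dual_axioms.intro form_functional_axioms
      assms ideal_annihilator annihilator_homogeneous)
    (simp_all add: annihilator_iff annihilator_above)

lemma artinian_gorenstein_annihilator:
  assumes "\<exists>u\<in>hom_polys n e. \<phi> u \<noteq> 0"
  shows "artinian_gorenstein n (annihilator n \<phi>)"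
proof -
  let ?I = "annihilator n \<phi>"
  interpret macaulay_dual n e \<phi> ?I by (rule macaulay_dual_annihilator[OF assms])
  interpret A: ring "galg n ?I" by (rule ring_galg)
  have ker: "\<phi> (p * y) = \<phi> (q * y)"
    if "p \<in> carrier (mpol_ring n)" "q \<in> carrier (mpol_ring n)" "y \<in> carrier (mpol_ring n)"
      "residue_class n ?I p = residue_class n ?I q" for p q y
    using that residue_eq_iff[of p q] vanish_mult[of "p - q" y] by (simp add: left_diff_distrib diff)
  have "artinian n ?I"
  proof -
    let ?M = "\<Union>i\<le>e. monoms n i"
    let ?V = "mp.span ((\<lambda>m. Poly_Mapping.single m (1::'k)) ` ?M)"
    have VC: "?V \<subseteq> carrier (mpol_ring n)"
      by (intro mp.span_minimal subspace_carrier) (auto intro: hom_polys_carrier single_in_hom_polys)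
    \<comment> \<open>Here the tests range over the whole ring, so a residual killed by all of them
      lies in \<open>?I\<close> by definition. Together with the vanishing above degree
      \<open>e\<close>, this yields a finite basis of the quotient.\<close>
    obtain d :: nat and g x :: "nat \<Rightarrow> 'k mpol" where
      g: "\<And>j. j < d \<Longrightarrow> g j \<in> ?V" and x: "\<And>j. j < d \<Longrightarrow> x j \<in> carrier (mpol_ring n)" and
      gx: "\<And>j l. j < d \<Longrightarrow> l < d \<Longrightarrow> \<phi> (g l * x j) = (if j = l then 1 else 0)" and
      res: "\<And>v y. v \<in> ?V \<Longrightarrow> y \<in> carrier (mpol_ring n) \<Longrightarrow>
        \<phi> ((v - (\<Sum>j<d. cscale (\<phi> (v * x j)) (g j))) * y) = 0"
      by (rule mp.biorthogonal_system[where V = ?V and X = "carrier (mpol_ring n)"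
            and f = "\<lambda>q p. \<phi> (p * q)" and B = "(\<lambda>m. Poly_Mapping.single m 1) ` ?M"])
        (auto simp: finite_monoms distrib_right add cscale_mult_left scale)
    have gC: "g j \<in> carrier (mpol_ring n)" if "j < d" for j
      using g[OF that] VC by blast
    have "A.dimension d (ground_field n ?I) (residue_class n ?I ` mp.span (g ` {..<d}))"
      unfolding ground_field_def
    proof (rule dimension_biorthogonal[OF residue_hom gC, where f = "\<lambda>j p. \<phi> (p * x j)"])
      show "\<phi> (p * x j) = \<phi> (q * x j)"
        if "j < d" "p \<in> carrier (mpol_ring n)" "q \<in> carrier (mpol_ring n)"
          "residue_class n ?I p = residue_class n ?I q" for j p q
        by (rule ker[OF that(2,3) x[OF that(1)] that(4)])
    qed (use gx in \<open>simp_all add: distrib_right add cscale_mult_left scale\<close>)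
    moreover have "residue_class n ?I ` mp.span (g ` {..<d}) = residue_class n ?I ` ?V"
    proof (rule residue_image_eqI[OF _ VC])
      show gV: "mp.span (g ` {..<d}) \<subseteq> ?V"
        using g by (intro mp.span_minimal mp.subspace_span) auto
      fix v assume v: "v \<in> ?V"
      let ?u = "\<Sum>j<d. cscale (\<phi> (v * x j)) (g j)"
      have "?u \<in> mp.span (g ` {..<d})"
        by (intro mp.span_sum mp.span_scale mp.span_base) auto
      moreover have "v - ?u \<in> carrier (mpol_ring n)"
        using v calculation gV VC by (intro mp.subspace_diff[OF subspace_carrier]) blast+
      then have "v - ?u \<in> ?I"
        unfolding annihilator_def using res[OF v] by blast
      ultimately show "\<exists>u\<in>mp.span (g ` {..<d}). v - u \<in> ?I" by blast
    qed
    moreover have "\<exists>u\<in>?V. v - u \<in> ?I" if "v \<in> carrier (mpol_ring n)" for v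
      using that
    proof (induction rule: carrier_induct)
      case subspace
      show ?case
      proof (rule mp.subspaceI; clarify)
        show "\<exists>u\<in>?V. 0 - u \<in> ?I"
          using mp.subspace_0[OF subspace_ideal] mp.span_zero by (intro bexI[of _ 0]) auto
        fix p q u w assume "u \<in> ?V" "p - u \<in> ?I" "w \<in> ?V" "q - w \<in> ?I"
        then show "\<exists>u\<in>?V. p + q - u \<in> ?I"
          using mp.subspace_add[OF subspace_ideal, of "p - u" "q - w"]
          by (intro bexI[of _ "u + w"] mp.span_add) (auto simp: algebra_simps)
      next
        fix c p u assume "u \<in> ?V" "p - u \<in> ?I"
        then show "\<exists>u\<in>?V. cscale c p - u \<in> ?I"
          using mp.subspace_scale[OF subspace_ideal, of "p - u" c]
          by (intro bexI[of _ "cscale c u"] mp.span_scale) (auto simp: mp.scale_right_diff_distrib)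
      qed
    next
      case (homogeneous q i)
      show ?case
      proof (cases "i \<le> e")
        case True
        then have "hom_polys n i \<subseteq> ?V"
          unfolding hom_polys_eq_span by (intro mp.span_mono) auto
        then show ?thesis
          using homogeneous mp.subspace_0[OF subspace_ideal] by (intro bexI[of _ q]) auto
      next
        case False
        then show ?thesis
          using above[OF homogeneous] mp.span_zero by (intro bexI[of _ 0]) auto
      qed
    qed
    then have "residue_class n ?I ` ?V = carrier (galg n ?I)"
      unfolding carrier_galg by (intro residue_image_eqI[OF VC]) auto
    ultimately show ?thesis
      unfolding artinian_def by (intro A.finite_dimensionI) simp
  qed
  moreover have "A.dimension 1 (ground_field n ?I) (socle n ?I)"
  proof -
    obtain u0 where u0: "u0 \<in> hom_polys n e" "\<phi> u0 \<noteq> 0" using assms by blast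
    define u where "u = cscale (inverse (\<phi> u0)) u0"
    have u: "u \<in> hom_polys n e" "\<phi> u = 1"
      using u0 by (simp_all add: u_def mp.subspace_scale[OF subspace_hom_polys] scale)
    have uC: "u \<in> carrier (mpol_ring n)" using u(1) by (rule hom_polys_carrier)
    let ?T = "{p \<in> carrier (mpol_ring n). \<forall>j<n. mpol_var j * p \<in> ?I}"
    have xu: "mpol_var j * u \<in> ?I" if "j < n" for j
      using above[OF hom_polys_mult[OF var_in_hom_polys[OF that] u(1)]] by simp
    have "A.dimension 1 (ground_field n ?I) (residue_class n ?I ` mp.span ((\<lambda>_. u) ` {..<1::nat}))"
      unfolding ground_field_def
    proof (rule dimension_biorthogonal[OF residue_hom, where f = "\<lambda>_. \<phi>"])
      show "\<phi> p = \<phi> q"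
        if "p \<in> carrier (mpol_ring n)" "q \<in> carrier (mpol_ring n)"
          "residue_class n ?I p = residue_class n ?I q" for p q
        using ker[OF that(1,2) hom_polys_carrier[OF one_in_hom_polys] that(3)] by simp
    qed (use u uC in \<open>simp_all add: add scale\<close>)
    moreover have "residue_class n ?I ` mp.span {u} = residue_class n ?I ` ?T"
    proof (rule residue_image_eqI)
      have "mp.subspace ?T"
        using subspace_carrier[of n] subspace_ideal
        by (auto simp: mp.subspace_def distrib_left cscale_mult_right)
      then show "mp.span {u} \<subseteq> ?T"
        using uC xu by (intro mp.span_minimal) auto
      fix p assume "p \<in> ?T"
      then have p: "p \<in> carrier (mpol_ring n)" and xp: "\<And>j. j < n \<Longrightarrow> mpol_var j * p \<in> ?I"
        by auto
      \<comment> \<open>By construction \<open>\<phi> ?r = 0\<close>, which settles test forms of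
        degree 0. A test form of higher degree contains a variable, and \<open>x_j ?r\<close> is in
        the ideal. So the socle is the line through the class of \<open>u\<close>.\<close>
      let ?r = "p - cscale (\<phi> p) u"
      have r: "?r \<in> carrier (mpol_ring n)"
        using p uC by (intro mp.subspace_diff mp.subspace_scale subspace_carrier)
      have xr: "mpol_var j * ?r \<in> ?I" if "j < n" for j
        using mp.subspace_diff[OF subspace_ideal xp[OF that]
            mp.subspace_scale[OF subspace_ideal xu[OF that], of "\<phi> p"]]
        by (simp add: right_diff_distrib cscale_mult_right)
      have "\<phi> (?r * q) = 0" if "q \<in> carrier (mpol_ring n)" for q
        using that
      proof (induction rule: carrier_induct)
        case subspace
        show ?case by (rule subspace_kernel)
      next
        case (homogeneous q i)
        show ?case
        proof (cases i)
          case 0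
          have "q \<in> hom_polys n 0" using homogeneous 0 by simp
          then show ?thesis
          proof (induction rule: hom_polys_induct)
            case subspace
            show ?case by (rule subspace_kernel)
          next
            case (monom m)
            then show ?case by (simp add: monoms_0 diff scale u)
          qed
        next
          case (Suc k)
          have "q \<in> hom_polys n (Suc k)" using homogeneous Suc by simp
          then show ?thesis
          proof (induction rule: hom_polys_Suc_induct)
            case subspace
            show ?case by (rule subspace_kernel)
          next
            case (var j q)
            have eq: "?r * (mpol_var j * q) = mpol_var j * ?r * q" by (simp only: ac_simps)
            show ?case
              unfolding eq by (rule vanish_mult[OF xr[OF var(1)] hom_polys_carrier[OF var(2)]])
          qed
        qed
      qed
      then have "?r \<in> ?I" unfolding annihilator_def using r by blast
      then show "\<exists>w\<in>mp.span {u}. p - w \<in> ?I"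
        by (intro bexI[of _ "cscale (\<phi> p) u"] mp.span_scale mp.span_base) auto
    qed auto
    moreover have "(\<lambda>_. u) ` {..<1::nat} = {u}" by auto
    ultimately show ?thesis by (simp add: socle_eq)
  qed
  moreover have "homogeneous_ideal n ?I"
    unfolding homogeneous_ideal_def using is_ideal homogeneous by blast
  ultimately show ?thesis by (simp add: artinian_gorenstein_def)
qed

end

section \<open>From an artinian Gorenstein ideal to its functional and socle degree\<close>

lemma weighted_sum_linear:
  fixes w :: "(nat \<Rightarrow>\<^sub>0 nat) \<Rightarrow> 'k::field"
  defines "\<phi> \<equiv> \<lambda>p. \<Sum>m\<in>Poly_Mapping.keys p. Poly_Mapping.lookup p m * w m"
  shows "\<phi> (p + q) = \<phi> p + \<phi> q" "\<phi> (cscale c p) = c * \<phi> p"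
proof -
  have sup: "\<phi> p = (\<Sum>m\<in>A. Poly_Mapping.lookup p m * w m)"
    if "finite A" "Poly_Mapping.keys p \<subseteq> A" for A p
    unfolding \<phi>_def using that by (intro sum.mono_neutral_left) (auto simp: in_keys_iff)
  let ?A = "Poly_Mapping.keys p \<union> Poly_Mapping.keys q"
  have "\<phi> (p + q) = (\<Sum>m\<in>?A. Poly_Mapping.lookup (p + q) m * w m)"
    using Poly_Mapping.keys_add[of p q] by (intro sup) auto
  then show "\<phi> (p + q) = \<phi> p + \<phi> q"
    by (simp add: sup[of ?A] lookup_add distrib_right sum.distrib)
  have "\<phi> (cscale c p) = (\<Sum>m\<in>Poly_Mapping.keys p. Poly_Mapping.lookup (cscale c p) m * w m)"
    by (rule sup) (auto simp: in_keys_iff)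
  then show "\<phi> (cscale c p) = c * \<phi> p"
    by (simp add: \<phi>_def sum_distrib_left mult.assoc)
qed

text \<open>The socle is $A_e$, so multiplication into $A_e \cong k$ is a perfect pairing; \<open>\<phi>\<close> is an
  isomorphism $A_e \cong k$, extended by zero to the other degrees.\<close>

lemma artinian_gorenstein_imp_dual:
  fixes I :: "'k::field mpol set"
  assumes AG: "artinian_gorenstein n I" and soc: "has_socle_degree n I e"
  obtains \<phi> where "macaulay_dual n e \<phi> I"
proof -
  from AG have ideal: "ideal I (mpol_ring n)" and
    hom: "\<And>p d. p \<in> I \<Longrightarrow> hom_comp d p \<in> I" and
    dim: "ring.dimension (galg n I) 1 (ground_field n I) (socle n I)"
    by (auto simp: artinian_gorenstein_def homogeneous_ideal_def)
  interpret mpol_ideal n I by (rule mpol_ideal.intro[OF ideal])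
  interpret A: ring "galg n I" by (rule ring_galg)
  obtain u where u: "u \<in> hom_polys n e" "u \<notin> I" and ab: "\<And>i. e < i \<Longrightarrow> hom_polys n i \<subseteq> I"
    using soc unfolding has_socle_degree_iff by blast
  have uC: "u \<in> carrier (mpol_ring n)" using u(1) by (rule hom_polys_carrier)
  have one: "1 \<notin> I"
    using mult_mem[of 1 u] u uC by auto
  note K = subfield_ground_field[OF one]
  let ?T = "{p \<in> carrier (mpol_ring n). \<forall>j<n. mpol_var j * p \<in> I}"
  have top: "p \<in> ?T" if p: "p \<in> hom_polys n e" for p
  proof -
    have "mpol_var j * p \<in> I" if "j < n" for j
      using ab[of "Suc e"] hom_polys_mult[OF var_in_hom_polys[OF that] p] by auto
    then show ?thesis using hom_polys_carrier[OF p] by blast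
  qed
  note uT = top[OF u(1)]
  have "A.dimension (Suc 0) (ground_field n I) (socle n I)" using dim by simp
  then obtain v E where vE: "v \<in> carrier (galg n I)" "A.dimension 0 (ground_field n I) E"
    "socle n I = A.line_extension (ground_field n I) v E"
    using A.dimension_backwards[OF K] by blast
  have v: "v \<in> carrier (galg n I)"
    "socle n I = A.line_extension (ground_field n I) v {\<zero>\<^bsub>galg n I\<^esub>}"
    using vE A.dimension_zero[OF K vE(2)] by auto
  obtain w where w: "w \<in> carrier (mpol_ring n)" "v = residue_class n I w"
    using v(1) by (auto simp: carrier_galg)
  have mult_w: "\<exists>b. p - cscale b w \<in> I" if p: "p \<in> ?T" for p
  proof -
    have "residue_class n I p \<in> socle n I" using p by (auto simp: socle_eq)
    then obtain b where "residue_class n I p =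
        residue_class n I (mpol_const b) \<otimes>\<^bsub>galg n I\<^esub> residue_class n I w \<oplus>\<^bsub>galg n I\<^esub> \<zero>\<^bsub>galg n I\<^esub>"
      unfolding v A.line_extension_mem_iff w ground_field_def by blast
    moreover have cC: "mpol_const b \<in> carrier (mpol_ring n)"
      by (rule hom_polys_carrier[OF const_in_hom_polys])
    moreover have bw: "cscale b w \<in> carrier (mpol_ring n)"
      by (rule mp.subspace_scale[OF subspace_carrier w(1)])
    moreover have "residue_class n I (cscale b w) \<in> carrier (galg n I)"
      using bw by (auto simp: carrier_galg)
    ultimately have "residue_class n I p = residue_class n I (cscale b w)"
      using w(1) by (simp add: residue_mult cscale_def)
    then show ?thesis using p bw by (subst (asm) residue_eq_iff) auto
  qed
  \<comment> \<open>The generator \<open>w\<close> of the socle comes without a degree. As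
    \<open>u\<close> is a nonzero multiple of it modulo \<open>I\<close>, the form \<open>u\<close>
    of degree \<open>e\<close> generates the same line.\<close>
  have mult_u: "\<exists>c. p - cscale c u \<in> I" if p: "p \<in> ?T" for p
  proof -
    obtain a where a: "u - cscale a w \<in> I" using mult_w[OF uT] by blast
    then have "a \<noteq> 0" using u(2) by auto
    obtain b where b: "p - cscale b w \<in> I" using mult_w[OF p] by blast
    have "p - cscale (b / a) u = (p - cscale b w) - cscale (b / a) (u - cscale a w)"
      using \<open>a \<noteq> 0\<close> by (simp add: mp.scale_right_diff_distrib)
    also have "\<dots> \<in> I"
      by (intro mp.subspace_diff mp.subspace_scale subspace_ideal a b)
    finally show ?thesis by blast
  qed
  have scale_u: "c = 0" if "cscale c u \<in> I" for c
  proof (rule ccontr)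
    assume "c \<noteq> 0"
    then show False
      using mp.subspace_scale[OF subspace_ideal that, of "inverse c"] u(2) by simp
  qed
  \<comment> \<open>The coordinate of the monomial \<open>m\<close> with respect to the basis
    element \<open>u\<close> of A_e.\<close>
  define \<gamma> where "\<gamma> m = (SOME c. Poly_Mapping.single m 1 - cscale c u \<in> I)" for m
  have \<gamma>: "Poly_Mapping.single m 1 - cscale (\<gamma> m) u \<in> I" if "m \<in> monoms n e" for m
    unfolding \<gamma>_def by (rule someI_ex) (rule mult_u[OF top[OF single_in_hom_polys[OF that]]])
  define \<phi> where "\<phi> p = (\<Sum>m\<in>Poly_Mapping.keys p. Poly_Mapping.lookup p m *
      (if monom_degree m = e then \<gamma> m else 0))" for p
  interpret form_functional n e \<phi>
  proof
    show "\<phi> (p + q) = \<phi> p + \<phi> q" "\<phi> (cscale c p) = c * \<phi> p" for p q c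
      unfolding \<phi>_def by (rule weighted_sum_linear)+
    show "\<phi> p = 0" if "p \<in> hom_polys n i" "i \<noteq> e" for p i
      using that by (auto simp: \<phi>_def keys_hom_polys monoms_def intro!: sum.neutral)
  qed
  have \<phi>u: "p - cscale (\<phi> p) u \<in> I" if "p \<in> hom_polys n e" for p
    using that
  proof (induction rule: hom_polys_induct)
    case subspace
    show ?case
    proof (rule mp.subspaceI; clarify)
      show "0 - cscale (\<phi> 0) u \<in> I" using mp.subspace_0[OF subspace_ideal] by (simp add: zero)
      show "p + q - cscale (\<phi> (p + q)) u \<in> I"
        if "p - cscale (\<phi> p) u \<in> I" "q - cscale (\<phi> q) u \<in> I" for p q
        using mp.subspace_add[OF subspace_ideal that]
        by (simp add: add algebra_simps)
      show "cscale c p - cscale (\<phi> (cscale c p)) u \<in> I" if "p - cscale (\<phi> p) u \<in> I" for c p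
        using mp.subspace_scale[OF subspace_ideal that, of c]
        by (simp add: scale mp.scale_right_diff_distrib)
    qed
  next
    case (monom m)
    then have "\<phi> (Poly_Mapping.single m 1) = \<gamma> m" by (simp add: \<phi>_def monoms_def)
    then show ?case using \<gamma>[OF monom] by simp
  qed
  have \<phi>_zero_iff: "\<phi> p = 0 \<longleftrightarrow> p \<in> I" if "p \<in> hom_polys n e" for p
  proof
    assume "p \<in> I"
    then have "cscale (\<phi> p) u \<in> I"
      using mp.subspace_diff[OF subspace_ideal _ \<phi>u[OF that], of p] by simp
    then show "\<phi> p = 0" by (rule scale_u)
  qed (use \<phi>u[OF that] in simp)
  have nondeg: "\<exists>q\<in>hom_polys n (e - i). \<phi> (p * q) \<noteq> 0"
    if "i \<le> e" "p \<in> hom_polys n i" "p \<notin> I" for i p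
    using that
  proof (induction i arbitrary: p rule: inc_induct)
    case base
    then show ?case
      using \<phi>_zero_iff one_in_hom_polys by (intro bexI[of _ 1]) auto
  next
    case (step i)
    \<comment> \<open>Otherwise \<open>p\<close> would be in the socle, hence a multiple of
      \<open>u\<close> modulo \<open>I\<close>. Since \<open>u\<close> has degree
      \<open>e > i\<close>, the degree-\<open>i\<close> component of that relation says
      \<open>p \<in> I\<close>.\<close>
    have "\<exists>j<n. mpol_var j * p \<notin> I"
    proof (rule ccontr)
      assume "\<not> ?thesis"
      then have "p \<in> ?T" using hom_polys_carrier[OF step.prems(1)] by blast
      then obtain c where "p - cscale c u \<in> I" using mult_u by blast
      then have "hom_comp i (p - cscale c u) \<in> I" by (rule hom)
      then have "p \<in> I"
        using step.hyps
        by (simp add: hom_comp_minus hom_comp_cscale hom_comp_hom_polys[OF step.prems(1)]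
            hom_comp_hom_polys[OF u(1)])
      then show False using step.prems by simp
    qed
    then obtain j where j: "j < n" "mpol_var j * p \<notin> I" by blast
    have "mpol_var j * p \<in> hom_polys n (Suc i)"
      using hom_polys_mult[OF var_in_hom_polys[OF j(1)] step.prems(1)] by simp
    then obtain q where q: "q \<in> hom_polys n (e - Suc i)" "\<phi> (mpol_var j * p * q) \<noteq> 0"
      using step.IH j(2) by blast
    have "mpol_var j * q \<in> hom_polys n (e - i)"
      using hom_polys_mult[OF var_in_hom_polys[OF j(1)] q(1)] step.hyps by (simp add: Suc_diff_Suc)
    moreover have "mpol_var j * p * q = p * (mpol_var j * q)" by (simp only: ac_simps)
    ultimately show ?case using q(2) by metis
  qed
  have "macaulay_dual n e \<phi> I"
  proof unfold_locales
    show "\<exists>u\<in>hom_polys n e. \<phi> u \<noteq> 0" using u \<phi>_zero_iff by blast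
    show "p \<in> I \<longleftrightarrow> (\<forall>q\<in>hom_polys n (e - i). \<phi> (p * q) = 0)" if "p \<in> hom_polys n i" "i \<le> e" for p i
    proof
      assume p: "p \<in> I"
      show "\<forall>q\<in>hom_polys n (e - i). \<phi> (p * q) = 0"
      proof
        fix q :: "'k mpol" assume q: "q \<in> hom_polys n (e - i)"
        then have "p * q \<in> hom_polys n e" using hom_polys_mult[OF that(1) q] that(2) by simp
        then show "\<phi> (p * q) = 0"
          using \<phi>_zero_iff mult_mem'[OF p hom_polys_carrier[OF q]] by blast
      qed
    qed (use nondeg that in blast)
  qed (use hom ab in auto)
  then show ?thesis by (rule that)
qed

text \<open>Once a graded piece vanishes, all later ones do. If the piece of degree
  \<open>d\<close>, the dimension of the algebra, were nonzero, nonzero classes of degrees 0 to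
  \<open>d\<close> would be \<open>d + 1\<close> independent elements.\<close>

lemma artinian_gorenstein_has_socle_degree:
  fixes I :: "'k::field mpol set"
  assumes "artinian_gorenstein n I"
  shows "\<exists>e. has_socle_degree n I e"
proof -
  from assms have ideal: "ideal I (mpol_ring n)" and
    hom: "\<And>p d. p \<in> I \<Longrightarrow> hom_comp d p \<in> I" and
    art: "artinian n I" and
    dim: "ring.dimension (galg n I) 1 (ground_field n I) (socle n I)"
    by (auto simp: artinian_gorenstein_def homogeneous_ideal_def)
  interpret mpol_ideal n I by (rule mpol_ideal.intro[OF ideal])
  interpret A: ring "galg n I" by (rule ring_galg)
  \<comment> \<open>In the zero ring the socle could not have dimension 1, as this requires an
    element outside a subspace that contains zero.\<close>
  have one: "1 \<notin> I"
  proof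
    assume "1 \<in> I"
    then have "carrier (galg n I) \<subseteq> {\<zero>\<^bsub>galg n I\<^esub>}"
      using mult_mem[of 1] residue_zero_iff by (auto simp: carrier_galg)
    moreover obtain v E where "v \<in> carrier (galg n I)" "v \<notin> E" "A.dimension 0 (ground_field n I) E"
      using dim by (cases rule: A.dimension.cases) auto
    moreover from this(3) have "\<zero>\<^bsub>galg n I\<^esub> \<in> E"
      by (cases rule: A.dimension.cases) auto
    ultimately show False by auto
  qed
  note K = subfield_ground_field[OF one]
  have up: "hom_polys n (Suc i) \<subseteq> I" if "hom_polys n i \<subseteq> I" for i
    unfolding hom_polys_Suc_eq_span
    using that mult_mem[OF _ hom_polys_carrier[OF var_in_hom_polys]]
    by (intro mp.span_minimal subspace_ideal) auto
  obtain d where d: "A.dimension d (ground_field n I) (carrier (galg n I))"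
    using art unfolding artinian_def by (rule A.finite_dimensionE')
  have vanish_d: "hom_polys n d \<subseteq> I"
  proof (rule ccontr)
    assume nd: "\<not> hom_polys n d \<subseteq> I"
    have "\<not> hom_polys n i \<subseteq> I" if "i \<le> d" for i
      using that by (induction i rule: inc_induct) (use nd up in blast)+
    then have "\<exists>p. p \<in> hom_polys n i \<and> p \<notin> I" if "i < Suc d" for i
      using that by (auto simp: less_Suc_eq_le)
    then obtain a where a: "\<And>i. i < Suc d \<Longrightarrow> a i \<in> hom_polys n i \<and> a i \<notin> I"
      by metis
    have aC: "a i \<in> carrier (mpol_ring n)" if "i < Suc d" for i
      using a[OF that] hom_polys_carrier by blast
    have "A.dimension (Suc d) (ground_field n I) (residue_class n I ` mp.span (a ` {..<Suc d}))"
      unfolding ground_field_def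
    proof (rule dimension_image_span[OF residue_hom aC])
      fix i assume i: "i < Suc d"
      have E: "mp.span (a ` {..<i}) \<subseteq> carrier (mpol_ring n)"
        using aC i by (intro mp.span_minimal subspace_carrier) auto
      have low: "mp.span (a ` {..<i}) \<subseteq> {p. hom_comp i p = 0}"
      proof (intro mp.span_minimal subspace_hom_comp_zero image_subsetI CollectI)
        fix j assume "j \<in> {..<i}"
        then show "hom_comp i (a j) = 0"
          using a[of j] i hom_comp_hom_polys[of "a j" n j i] by auto
      qed
      show "residue_class n I (a i) \<notin> residue_class n I ` mp.span (a ` {..<i})"
      proof
        assume "residue_class n I (a i) \<in> residue_class n I ` mp.span (a ` {..<i})"
        then obtain b where b: "b \<in> mp.span (a ` {..<i})"
            "residue_class n I (a i) = residue_class n I b"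
          by blast
        then have "a i - b \<in> I" using residue_eq_iff[OF aC[OF i]] E by blast
        then have "hom_comp i (a i - b) \<in> I" by (rule hom)
        moreover have "hom_comp i b = 0" using b(1) low by blast
        ultimately show False
          using a[OF i] hom_comp_hom_polys[of "a i" n i i] by (simp add: hom_comp_minus)
      qed
    qed
    then obtain Vs where Vs: "A.independent (ground_field n I) Vs" "length Vs = Suc d"
        "set Vs \<subseteq> carrier (galg n I)"
      using A.exists_base[OF K] by blast
    then show False
      using A.independent_length_le_dimension[OF K d Vs(1,3)] by simp
  qed
  have vanish: "hom_polys n i \<subseteq> I" if "d \<le> i" for i
    using that by (induction i rule: dec_induct) (use vanish_d up in blast)+
  define N where "N = (LEAST N. \<forall>i\<ge>N. hom_polys n i \<subseteq> I)"
  have N: "\<forall>i\<ge>N. hom_polys n i \<subseteq> I"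
    unfolding N_def by (rule LeastI_ex) (use vanish in blast)
  have "\<not> hom_polys n 0 \<subseteq> I" using one one_in_hom_polys by blast
  then obtain e where e: "N = Suc e" using N by (cases N) auto
  have "\<not> hom_polys n e \<subseteq> I"
  proof
    assume "hom_polys n e \<subseteq> I"
    then have "\<forall>i\<ge>e. hom_polys n i \<subseteq> I"
      using N e by (metis le_antisym not_less_eq_eq)
    then show False
      using Least_le[of "\<lambda>N. \<forall>i\<ge>N. hom_polys n i \<subseteq> I" e] e by (simp add: N_def)
  qed
  then have "has_socle_degree n I e"
    unfolding has_socle_degree_iff using N e by (auto simp: Suc_le_eq)
  then show ?thesis by blast
qed

section \<open>Lefschetz elements in the middle degree\<close>

context vector_space
begin

text \<open>A basis of \<open>U\<close> together with one vector of \<open>W\<close> outside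
  \<open>U\<close> extends to a basis of \<open>W\<close>; the spanning set \<open>B\<close> keeps
  it finite, so the cardinalities compare strictly.\<close>

lemma dim_less_of_psubset:
  assumes U: "subspace U" and UW: "U \<subset> W" and B: "finite B" "W \<subseteq> span B"
  shows "dim U < dim W"
proof -
  obtain BU where BU: "BU \<subseteq> U" "independent BU" "U \<subseteq> span BU"
    using maximal_independent_subset by blast
  obtain w where w: "w \<in> W" "w \<notin> U" using UW by blast
  have "w \<notin> span BU" using w(2) span_minimal[OF BU(1) U] by blast
  then have "independent (insert w BU)" using BU(2) by (rule independent_insertI)
  then obtain BW where BW: "insert w BU \<subseteq> BW" "BW \<subseteq> W" "independent BW" "W \<subseteq> span BW"
    using maximal_independent_subset_extend[of "insert w BU" W] w(1) BU(1) UW by blast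
  have "finite BW" using independent_span_bound[OF B(1) BW(3)] BW(2) B(2) by blast
  moreover have "BU \<subset> BW" using BW(1) w(2) BU(1) by blast
  ultimately have "card BU < card BW" by (rule psubset_card_mono)
  then show ?thesis
    using basis_card_eq_dim[OF BU(1,3,2)] basis_card_eq_dim[OF BW(2,4,3)] by simp
qed

text \<open>If every $b_0 + t b_1$ with $t \neq 0$ had too large a kernel, it would contain some
  $v_t$ outside the kernel of $b_0$. As for eigenvectors with distinct eigenvalues, the $v_t$ are
  linearly independent modulo the kernel of $b_0$, and there are infinitely many of them.\<close>

lemma kernel_pencil:
  fixes b0 b1 :: "'x \<Rightarrow> 'b \<Rightarrow> 'a"
  assumes inf: "infinite (UNIV :: 'a set)"
    and V: "subspace V" and B: "finite B" "V \<subseteq> span B"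
    and add0: "\<And>y u v. b0 y (u + v) = b0 y u + b0 y v" and sc0: "\<And>y c v. b0 y (c *s v) = c * b0 y v"
    and add1: "\<And>y u v. b1 y (u + v) = b1 y u + b1 y v" and sc1: "\<And>y c v. b1 y (c *s v) = c * b1 y v"
    and ker: "\<And>v y. v \<in> V \<Longrightarrow> (\<And>y. y \<in> X \<Longrightarrow> b0 y v = 0) \<Longrightarrow> y \<in> X \<Longrightarrow> b1 y v = 0"
  shows "\<exists>t. t \<noteq> 0 \<and> (\<forall>v\<in>V. (\<forall>y\<in>X. b0 y v + t * b1 y v = 0) \<longrightarrow> (\<forall>y\<in>X. b0 y v = 0))"
proof (rule ccontr)
  assume "\<not> ?thesis"
  then have "\<exists>v. v \<in> V \<and> (\<forall>y\<in>X. b0 y v + t * b1 y v = 0) \<and> (\<exists>y\<in>X. b0 y v \<noteq> 0)" if "t \<noteq> 0" for t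
    using that by blast
  then obtain v where v: "\<And>t. t \<noteq> 0 \<Longrightarrow> v t \<in> V"
    and eig: "\<And>t y. t \<noteq> 0 \<Longrightarrow> y \<in> X \<Longrightarrow> b0 y (v t) + t * b1 y (v t) = 0"
    and nz: "\<And>t. t \<noteq> 0 \<Longrightarrow> \<exists>y\<in>X. b0 y (v t) \<noteq> 0"
    by metis
  have z0: "b0 y 0 = 0" and z1: "b1 y 0 = 0" for y
    using sc0[of y 0 0] sc1[of y 0 0] by simp_all
  have sum0: "b0 y (\<Sum>t\<in>T. c t *s v t) = (\<Sum>t\<in>T. c t * b0 y (v t))"
    and sum1: "b1 y (\<Sum>t\<in>T. c t *s v t) = (\<Sum>t\<in>T. c t * b1 y (v t))" for y c T
    by (induction T rule: infinite_finite_induct) (simp_all add: z0 z1 add0 add1 sc0 sc1)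
  have indep: "\<forall>t\<in>T. c t = 0"
    if "finite T" "0 \<notin> T" "\<And>y. y \<in> X \<Longrightarrow> b0 y (\<Sum>t\<in>T. c t *s v t) = 0" for T c
    using that
  proof (induction T arbitrary: c rule: finite_induct)
    case empty
    then show ?case by simp
  next
    case (insert s T)
    have s: "s \<noteq> 0" "0 \<notin> T" using insert.prems(1) by auto
    let ?u = "\<Sum>t\<in>insert s T. c t *s v t"
    have "?u \<in> V"
      by (intro subspace_sum[OF V] subspace_scale[OF V] v) (use insert.prems(1) in metis)
    then have b1u: "b1 y ?u = 0" if "y \<in> X" for y
      using ker[of ?u] insert.prems(2) that by blast
    \<comment> \<open>The sum \<open>?u\<close> is killed by \<open>b0\<close> and hence by
      \<open>b1\<close>. In \<open>b0 + s * b1\<close> the term of \<open>v s\<close> drops out, and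
      that of \<open>v t\<close> gains the factor \<open>1 - s / t\<close>, because
      \<open>b1 y (v t)\<close> is \<open>- b0 y (v t) / t\<close>. What remains is a relation over
      \<open>T\<close>, and the factor is nonzero for \<open>t \<noteq> s\<close>.\<close>
    have "\<forall>t\<in>T. c t * (1 - s / t) = 0"
    proof (rule insert.IH[OF s(2)])
      fix y assume y: "y \<in> X"
      have "0 = b0 y ?u + s * b1 y ?u"
        using insert.prems(2)[OF y] b1u[OF y] by simp
      also have "\<dots> = (\<Sum>t\<in>insert s T. c t * (b0 y (v t) + s * b1 y (v t)))"
        unfolding sum0 sum1 by (simp add: sum_distrib_left sum.distrib algebra_simps)
      also have "\<dots> = (\<Sum>t\<in>T. c t * (b0 y (v t) + s * b1 y (v t)))"
        using insert.hyps eig[OF s(1) y] by simp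
      also have "\<dots> = (\<Sum>t\<in>T. c t * (1 - s / t) * b0 y (v t))"
      proof (rule sum.cong[OF refl])
        fix t assume "t \<in> T"
        then have t: "t \<noteq> 0" using s(2) by blast
        have eq: "b0 y (v t) = - (t * b1 y (v t))"
          using eig[OF t y] by (simp add: add_eq_0_iff2)
        show "c t * (b0 y (v t) + s * b1 y (v t)) = c t * (1 - s / t) * b0 y (v t)"
          unfolding eq using t by (simp add: field_simps)
      qed
      finally show "b0 y (\<Sum>t\<in>T. (c t * (1 - s / t)) *s v t) = 0"
        by (simp add: sum0)
    qed
    then have "\<forall>t\<in>T. c t = 0 \<or> s = t" by auto
    then have cT: "\<forall>t\<in>T. c t = 0" using insert.hyps(2) by blast
    then have "?u = c s *s v s"
      using insert.hyps by (simp add: sum.neutral)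
    then have "\<forall>y\<in>X. c s * b0 y (v s) = 0"
      using insert.prems(2) by (simp add: sc0)
    then have "c s = 0" using nz[OF s(1)] by auto
    then show ?case using cT by simp
  qed
  have "infinite (UNIV - {0 :: 'a})" using inf by simp
  then obtain T where T: "T \<subseteq> UNIV - {0 :: 'a}" "finite T" "card T = Suc (card B)"
    using infinite_arbitrarily_large by blast
  have 0: "0 \<notin> T" using T(1) by blast
  have inj: "inj_on v T"
  proof (rule inj_onI, rule ccontr)
    fix s t assume st: "s \<in> T" "t \<in> T" "v s = v t" "s \<noteq> t"
    have "\<forall>r\<in>{s, t}. (if r = s then 1 else - 1 :: 'a) = 0"
    proof (rule indep)
      show "b0 y (\<Sum>r\<in>{s, t}. (if r = s then 1 else - 1) *s v r) = 0" for y
        using st(3,4) z0 by simp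
    qed (use st 0 in auto)
    then show False by simp
  qed
  have "independent (v ` T)"
  proof (rule independent_if_scalars_zero)
    fix k w assume 0: "(\<Sum>w\<in>v ` T. k w *s w) = 0" and w: "w \<in> v ` T"
    have "(\<Sum>t\<in>T. k (v t) *s v t) = 0"
      using 0 unfolding sum.reindex[OF inj] by (simp add: o_def)
    then have "\<forall>t\<in>T. k (v t) = 0"
      using indep[OF T(2) \<open>0 \<notin> T\<close>, of "\<lambda>t. k (v t)"] z0 by simp
    then show "k w = 0" using w by blast
  qed (use T in simp)
  moreover have "v ` T \<subseteq> span B"
  proof (rule image_subsetI)
    fix t assume "t \<in> T"
    then have "t \<noteq> 0" using 0 by metis
    then show "v t \<in> span B" using v B(2) by (metis subsetD)
  qed
  ultimately have "card (v ` T) \<le> card B" using independent_span_bound[OF B(1)] by blast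
  then show False using T(3) by (simp add: card_image[OF inj])
qed

end

text \<open>Used contrapositively: a point at which a form of positive degree does not vanish has a
  nonzero coordinate among the first \<open>n\<close>.\<close>

lemma subst_at_origin:
  assumes "p \<in> hom_polys n (Suc i)" "\<And>j. j < n \<Longrightarrow> x j = 0"
  shows "subst (\<lambda>c. c) x p = 0"
  using assms(1)
proof (induction rule: hom_polys_Suc_induct)
  case subspace
  show ?case by (auto simp: mp.subspace_def id_coeff.subst_add id_coeff.subst_cscale)
qed (simp add: id_coeff.subst_mult id_coeff.subst_var assms(2))

text \<open>Here \<open>c\<close> is both the number of variables and the codimension, so the ideals
  concerned contain no nonzero linear form.\<close>

definition compressed_have_wlp :: "'k::field itself \<Rightarrow> nat \<Rightarrow> nat \<Rightarrow> bool" where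
  "compressed_have_wlp _ c e \<longleftrightarrow> (\<forall>I :: 'k mpol set.
    compressed_gorenstein c I \<and> codimension c I = c \<and> has_socle_degree c I e \<longrightarrow> weak_lefschetz c I)"

text \<open>Adding to \<open>\<phi>\<close> the evaluations of the degree-\<open>e\<close> part at points dual to a basis of the
  degree-\<open>m\<close> part of the annihilator makes the algebra compressed. A linear form that works for
  the compressed algebra works for \<open>\<phi>\<close>, since modulo that basis every polynomial of degree \<open>m\<close>
  vanishes at the points.\<close>

lemma injective_middle_odd:
  fixes \<phi> :: "'k::field mpol \<Rightarrow> 'k"
  assumes inf: "infinite (UNIV :: 'k set)" and form: "form_functional c (2 * m + 1) \<phi>"
    and "0 < m" "0 < c" and wlp: "compressed_have_wlp TYPE('k) c (2 * m + 1)"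
  shows "\<exists>L\<in>hom_polys c 1. \<forall>p\<in>hom_polys c m.
    (\<forall>q\<in>hom_polys c m. \<phi> (L * p * q) = 0) \<longrightarrow> (\<forall>q\<in>hom_polys c (m + 1). \<phi> (p * q) = 0)"
proof -
  define e where "e = 2 * m + 1"
  interpret P: form_functional c e \<phi> using form by (simp add: e_def)
  let ?ev = "subst (\<lambda>c. c :: 'k)"
  define V where "V = {p \<in> hom_polys c m. \<forall>q\<in>hom_polys c (m + 1). \<phi> (p * q) = 0}"
  have V: "mp.subspace V"
    using subspace_hom_polys[of c m]
    by (auto simp: V_def mp.subspace_def distrib_right P.add P.zero cscale_mult_left P.scale)
  have V_sub: "V \<subseteq> hom_polys c m" by (auto simp: V_def)
  obtain d :: nat and g x where
    g: "\<And>j. j < d \<Longrightarrow> g j \<in> V" and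
    xg: "\<And>i j. i < d \<Longrightarrow> j < d \<Longrightarrow> ?ev (x i) (g j) = (if i = j then 1 else 0)" and
    res: "\<And>v y. v \<in> V \<Longrightarrow> ?ev y (v - (\<Sum>j<d. cscale (?ev (x j) v) (g j))) = 0"
    by (rule mp.biorthogonal_system[where V = V and X = UNIV and f = ?ev
          and B = "(\<lambda>m. Poly_Mapping.single m 1) ` monoms c m"])
      (use V_sub in \<open>auto simp: V finite_monoms hom_polys_eq_span[symmetric] id_coeff.subst_add
        id_coeff.subst_cscale\<close>)
  have gS: "g j \<in> hom_polys c m" if "j < d" for j using g[OF that] by (simp add: V_def)
  have g_perp: "\<phi> (g j * q) = 0" if "j < d" "q \<in> hom_polys c (m + 1)" for j q
    using g[OF that(1)] that(2) by (simp add: V_def)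
  \<comment> \<open>A residual vanishing at every point is the zero polynomial over an infinite
    field. So the \<open>g j\<close> span \<open>V\<close>, and an element of \<open>V\<close> is
    determined by its values at the chosen points.\<close>
  have V_res: "v = (\<Sum>j<d. cscale (?ev (x j) v) (g j))" if "v \<in> V" for v
    using exists_nonzero_point[OF inf, of "v - (\<Sum>j<d. cscale (?ev (x j) v) (g j))"] res[OF that]
    by auto
  \<comment> \<open>Evaluating only the component of degree \<open>e\<close> keeps the functional
    supported in that degree; on products of complementary degree the evaluations still
    multiply.\<close>
  define \<psi> where "\<psi> p = \<phi> p + (\<Sum>j<d. ?ev (x j) (hom_comp e p))" for p
  interpret Q: form_functional c e \<psi>
    by unfold_locales
      (simp_all add: \<psi>_def P.add P.scale P.other_degree hom_comp_add hom_comp_cscale hom_comp_hom_polys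
        id_coeff.subst_add id_coeff.subst_cscale sum.distrib sum_distrib_left distrib_left)
  have \<psi>_mult: "\<psi> (p * q) = \<phi> (p * q) + (\<Sum>j<d. ?ev (x j) p * ?ev (x j) q)"
    if "p \<in> hom_polys c i" "q \<in> hom_polys c (e - i)" "i \<le> e" for p q i
    using hom_comp_hom_polys[OF hom_polys_mult[OF that(1,2)], of e] that(3)
    by (simp add: \<psi>_def id_coeff.subst_mult)
  have em: "e - m = m + 1" "e - (m + 1) = m" "m \<le> e" "m + 1 \<le> e" by (simp_all add: e_def)
  have nondeg: "p = 0" if p: "p \<in> hom_polys c m" and 0: "\<forall>q\<in>hom_polys c (m + 1). \<psi> (p * q) = 0" for p
  proof -
    have evp: "?ev (x j) p = 0" if j: "j < d" for j
    proof -
      have "g j \<in> hom_polys c (Suc (m - 1))" using gS[OF j] \<open>0 < m\<close> by simp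
      then obtain l where l: "l < c" "x j l \<noteq> 0"
        using subst_at_origin[of "g j" c "m - 1" "x j"] xg[OF j j] by auto
      \<comment> \<open>Multiplied by \<open>p\<close>, this form is invisible to \<phi> because
        \<open>g j \<in> V\<close>, and it vanishes at all chosen points except \<open>x j\<close>.
        There it equals \<open>x j l\<close>, which is nonzero, so \<psi> reads off the value of
        \<open>p\<close> at \<open>x j\<close>.\<close>
      let ?q = "mpol_var l * g j"
      have q: "?q \<in> hom_polys c (m + 1)"
        using hom_polys_mult[OF var_in_hom_polys[OF l(1)] gS[OF j]] by simp
      have "mpol_var l * p \<in> hom_polys c (m + 1)"
        using hom_polys_mult[OF var_in_hom_polys[OF l(1)] p] by simp
      then have "\<phi> (p * ?q) = 0"
        using g_perp[OF j, of "mpol_var l * p"] by (simp add: ac_simps)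
      moreover have "(\<Sum>i<d. ?ev (x i) p * ?ev (x i) ?q) = (\<Sum>i<d. if i = j then ?ev (x j) p * x j l else 0)"
        using xg j by (intro sum.cong) (auto simp: id_coeff.subst_mult id_coeff.subst_var)
      ultimately have "\<psi> (p * ?q) = ?ev (x j) p * x j l"
        using \<psi>_mult[OF p, of ?q] q em j by simp
      then show ?thesis using 0 q l(2) by simp
    qed
    have "p \<in> V"
      unfolding V_def
    proof (intro CollectI conjI ballI p)
      fix q :: "'k mpol" assume q: "q \<in> hom_polys c (m + 1)"
      then show "\<phi> (p * q) = 0"
        using 0 \<psi>_mult[OF p, of q] em evp by simp
    qed
    then have "p = (\<Sum>j<d. cscale (?ev (x j) p) (g j))" by (rule V_res)
    also have "\<dots> = 0" using evp by (intro sum.neutral) simp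
    finally show "p = 0" .
  qed
  define I where "I = annihilator c \<psi>"
  let ?x0 = "\<lambda>k::nat. Poly_Mapping.single (Poly_Mapping.single (0::nat) k) (1::'k)"
  have x0: "?x0 k \<in> hom_polys c k" for k
    using \<open>0 < c\<close> by (intro single_in_hom_polys single_in_monoms)
  have x0_nz: "?x0 k \<noteq> 0" for k
    using lookup_single_eq[of "Poly_Mapping.single (0::nat) k" "1::'k"] by (metis lookup_zero zero_neq_one)
  have "\<exists>q\<in>hom_polys c (m + 1). \<psi> (?x0 m * q) \<noteq> 0"
    using nondeg[OF x0] x0_nz by blast
  then have nz: "\<exists>u\<in>hom_polys c e. \<psi> u \<noteq> 0"
    using hom_polys_mult[OF x0[of m]] by (fastforce simp: e_def mult_2)
  interpret D: macaulay_dual c e \<psi> I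
    unfolding I_def by (rule Q.macaulay_dual_annihilator[OF nz])
  \<comment> \<open>A power of the first variable lifts \<open>p\<close> to degree \<open>m\<close>,
    where the ideal contains only zero; polynomials have no zero divisors.\<close>
  have I_low: "p = 0" if "p \<in> hom_polys c i" "p \<in> I" "i \<le> m" for p i
  proof -
    have xp: "?x0 (m - i) * p \<in> hom_polys c m"
      using hom_polys_mult[OF x0[of "m - i"] that(1)] that(3) by simp
    have "?x0 (m - i) * p \<in> I"
      by (rule D.mult_mem[OF that(2) hom_polys_carrier[OF x0]])
    then have "\<forall>q\<in>hom_polys c (m + 1). \<psi> (?x0 (m - i) * p * q) = 0"
      using D.mem_iff[OF xp em(3)] em by simp
    then have "?x0 (m - i) * p = 0" using nondeg[OF xp] by simp
    then show "p = 0" using x0_nz by simp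
  qed
  have hvec_low: "hvec c I i = card (monoms c i)" if "i \<le> m" for i
    by (rule D.hvec_eq_card_monoms[OF D.one_notin I_low[OF _ _ that]])
  have codim: "codimension c I = c"
    using hvec_low[of 1] \<open>0 < m\<close> card_monoms_1 by (simp add: codimension_def)
  have "compressed_gorenstein c I"
    unfolding compressed_gorenstein_def
  proof (intro conjI exI[of _ e] allI impI)
    show "artinian_gorenstein c I"
      unfolding I_def by (rule Q.artinian_gorenstein_annihilator[OF nz])
    show "has_socle_degree c I e" by (rule D.socle_degree)
    fix i assume i: "i \<le> e"
    show "hvec c I i = min (dim_hom_polys TYPE('k) (codimension c I) i)
        (dim_hom_polys TYPE('k) (codimension c I) (e - i))"
    \<comment> \<open>Up to degree \<open>m\<close> the ideal is zero, above it the symmetry of the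
      \<open>h\<close>-vector applies; monotonicity of the number of monomials tells which entry is
      the minimum.\<close>
    proof (cases "i \<le> m")
      case True
      then show ?thesis
        using hvec_low[OF True] card_monoms_mono[OF \<open>0 < c\<close>, of i "e - i"]
        by (simp add: codim dim_hom_polys_eq e_def)
    next
      case False
      then have "e - i \<le> m" "e - i \<le> i" by (simp_all add: e_def)
      then show ?thesis
        using hvec_low[of "e - i"] card_monoms_mono[OF \<open>0 < c\<close>, of "e - i" i]
          D.hvec_symmetric[OF i] by (simp add: codim dim_hom_polys_eq)
    qed
  qed
  then have "weak_lefschetz c I"
    using wlp codim D.socle_degree unfolding compressed_have_wlp_def e_def by blast
  then obtain L where L: "L \<in> hom_polys c 1"
    and inj: "\<And>p. p \<in> hom_polys c m \<Longrightarrow> L * p \<in> I \<Longrightarrow> p \<in> I"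
    using D.weak_lefschetzE[OF _ e_def] by blast
  show ?thesis
  proof (intro bexI[OF _ L] ballI impI)
    fix p q :: "'k mpol" assume p: "p \<in> hom_polys c m"
      and 0: "\<forall>q\<in>hom_polys c m. \<phi> (L * p * q) = 0" and q: "q \<in> hom_polys c (m + 1)"
    \<comment> \<open>\<open>?s\<close> interpolates \<open>p\<close> at the points by an element of
      \<open>V\<close>. The difference \<open>?r\<close> vanishes there, so \<phi> and \<psi> agree
      on \<open>L * ?r * t\<close>, while \<phi> does not see \<open>?s\<close>. This transfers the
      hypothesis on \<open>p\<close> to the compressed algebra.\<close>
    let ?s = "\<Sum>j<d. cscale (?ev (x j) p) (g j)"
    let ?r = "p - ?s"
    have sV: "?s \<in> V" using g by (intro mp.subspace_sum mp.subspace_scale V) auto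
    have r: "?r \<in> hom_polys c m"
      using p sV by (intro mp.subspace_diff subspace_hom_polys) (auto simp: V_def)
    have ev_sum: "?ev y ?s = (\<Sum>j<d. ?ev (x j) p * ?ev y (g j))" for y
    proof -
      have "?ev y (\<Sum>j\<in>A. cscale (?ev (x j) p) (g j)) = (\<Sum>j\<in>A. ?ev (x j) p * ?ev y (g j))"
        if "finite A" for A :: "nat set"
        using that by induction (simp_all add: id_coeff.subst_add id_coeff.subst_cscale)
      then show ?thesis by simp
    qed
    have evr: "?ev (x i) ?r = 0" if i: "i < d" for i
    proof -
      have "?ev (x i) ?s = (\<Sum>j<d. if j = i then ?ev (x i) p else 0)"
        unfolding ev_sum using xg i by (intro sum.cong) auto
      then have "?ev (x i) ?s = ?ev (x i) p" using i by simp
      moreover have "?ev (x i) p = ?ev (x i) ?r + ?ev (x i) ?s"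
        by (simp add: id_coeff.subst_add[symmetric])
      ultimately show ?thesis by simp
    qed
    have Lr: "L * ?r \<in> hom_polys c (m + 1)" using hom_polys_mult[OF L r] by simp
    have "L * ?r \<in> I"
    proof (subst D.mem_iff[OF Lr em(4)], unfold em, rule ballI)
      fix t :: "'k mpol" assume t: "t \<in> hom_polys c m"
      have "L * t \<in> hom_polys c (m + 1)" using hom_polys_mult[OF L t] by simp
      then have "\<phi> (?s * (L * t)) = 0" using sV by (simp add: V_def)
      then have "\<phi> (L * ?r * t) = 0"
        using bspec[OF 0 t] by (simp add: right_diff_distrib left_diff_distrib P.diff ac_simps)
      then show "\<psi> (L * ?r * t) = 0"
        using \<psi>_mult[OF Lr, of t] t em evr by (simp add: id_coeff.subst_mult)
    qed
    then have "?r = 0" using inj[OF r] I_low[OF r] by blast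
    then have "p \<in> V" using sV by simp
    then show "\<phi> (p * q) = 0" using q by (simp add: V_def)
  qed
qed

text \<open>In detail: choose \<open>L\<close> such that the kernel \<open>K L\<close> of $L \colon A_m \to A_{m+1}$ has minimal
  dimension, and let \<open>L'\<close> be a Lefschetz element in degree \<open>m\<close> for the algebra of $\varphi(L \cdot)$, which has odd
  socle degree. The kernel of $LL'$ on $A_m$ is then \<open>K L\<close>, and so is that of $L(L' + tM)$ for any
  linear form \<open>M\<close> and a suitable $t \neq 0$. By minimality \<open>L'\<close> and $L' + tM$ have kernel \<open>K L\<close> on
  $A_m$, so \<open>M\<close> kills \<open>K L\<close>. Hence \<open>K L\<close> lies in the socle.\<close>

lemma injective_middle_even:
  fixes \<phi> :: "'k::field mpol \<Rightarrow> 'k"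
  assumes inf: "infinite (UNIV :: 'k set)" and form: "form_functional c (2 * m + 2) \<phi>"
    and "0 < m" "0 < c" and wlp: "compressed_have_wlp TYPE('k) c (2 * m + 1)"
  shows "\<exists>L\<in>hom_polys c 1. \<forall>p\<in>hom_polys c m.
    (\<forall>q\<in>hom_polys c (m + 1). \<phi> (L * p * q) = 0) \<longrightarrow> (\<forall>q\<in>hom_polys c (m + 2). \<phi> (p * q) = 0)"
proof -
  interpret P: form_functional c "2 * m + 2" \<phi> by (rule form)
  define K where "K L = {p \<in> hom_polys c m. \<forall>q\<in>hom_polys c (m + 1). \<phi> (L * p * q) = 0}" for L
  have K_sub: "mp.subspace (K L)" for L
    using subspace_hom_polys[of c m]
    by (auto simp: K_def mp.subspace_def distrib_left distrib_right P.add P.zero cscale_mult_left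
        cscale_mult_right P.scale)
  have K_mono: "K L \<subseteq> hom_polys c m" for L by (auto simp: K_def)
  obtain L where L: "L \<in> hom_polys c 1"
    and min: "\<And>N. N \<in> hom_polys c 1 \<Longrightarrow> mp.dim (K L) \<le> mp.dim (K N)"
    using ex_has_least_nat[of "\<lambda>N. N \<in> hom_polys c 1" 0 "\<lambda>N. mp.dim (K N)"] by auto
  have K_eq: "K N = K L" if "N \<in> hom_polys c 1" "K N \<subseteq> K L" for N
  proof (rule ccontr)
    assume "K N \<noteq> K L"
    then have "mp.dim (K N) < mp.dim (K L)"
      using that(2) K_mono[of L] finite_monoms[of c m]
      by (intro mp.dim_less_of_psubset[where B = "(\<lambda>m. Poly_Mapping.single m 1) ` monoms c m"] K_sub)
        (auto simp: hom_polys_eq_span)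
    then show False using min[OF that(1)] by simp
  qed
  \<comment> \<open>The ideal of this functional in degree \<open>m\<close> is \<open>K L\<close>,
    so the odd case yields: if \<phi> kills all \<open>L * L' * p * q\<close>, then
    \<open>p \<in> K L\<close>. The functional may be zero, which the odd case allows.\<close>
  have form': "form_functional c (2 * m + 1) (\<lambda>p. \<phi> (L * p))"
  proof
    show "\<phi> (L * p) = 0" if "p \<in> hom_polys c i" "i \<noteq> 2 * m + 1" for p i
      using P.other_degree[OF hom_polys_mult[OF L that(1)]] that(2) by simp
  qed (simp_all add: distrib_left P.add cscale_mult_right P.scale)
  obtain L' where L': "L' \<in> hom_polys c 1"
    and LL': "\<forall>p\<in>hom_polys c m. (\<forall>q\<in>hom_polys c m. \<phi> (L * (L' * p * q)) = 0) \<longrightarrow>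
      (\<forall>q\<in>hom_polys c (m + 1). \<phi> (L * (p * q)) = 0)"
    using injective_middle_odd[OF inf form' \<open>0 < m\<close> \<open>0 < c\<close> wlp] by blast
  have mult_low: "N * q \<in> hom_polys c (m + 1)" if "N \<in> hom_polys c 1" "q \<in> hom_polys c m" for N q :: "'k mpol"
    using hom_polys_mult[OF that] by simp
  have in_K: "p \<in> K L" if "p \<in> hom_polys c m" "\<And>q. q \<in> hom_polys c m \<Longrightarrow> \<phi> (L * (L' * p * q)) = 0" for p
    unfolding K_def using that LL' by (simp add: mult.assoc)
  have K_L': "K L' = K L"
  \<comment> \<open>Multiplying by \<open>L\<close> shows that the kernel of \<open>L'\<close> is
    inside that of \<open>L * L'\<close>, which is \<open>K L\<close>; minimality turns the
    inclusion into an equality.\<close>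
  proof (rule K_eq[OF L'], rule subsetI)
    fix p assume p: "p \<in> K L'"
    show "p \<in> K L"
    proof (rule in_K)
      show "p \<in> hom_polys c m" using p by (simp add: K_def)
      fix q :: "'k mpol" assume q: "q \<in> hom_polys c m"
      have "\<phi> (L' * p * (L * q)) = 0" using p mult_low[OF L q] by (simp add: K_def)
      then show "\<phi> (L * (L' * p * q)) = 0" by (simp add: ac_simps)
    qed
  qed
  have killed: "\<phi> (M * p * q) = 0"
    if M: "M \<in> hom_polys c 1" and p: "p \<in> K L" and q: "q \<in> hom_polys c (m + 1)" for M p q
  proof -
    \<comment> \<open>The two families of functionals describe multiplication by
      \<open>L * L'\<close> and by \<open>L * M\<close> from degree \<open>m\<close> to
      \<open>m + 2\<close>. The former has kernel \<open>K L\<close>, which the latter kills as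
      well; this is the kernel inclusion that a pencil requires.\<close>
    have "\<exists>t. t \<noteq> 0 \<and> (\<forall>v\<in>hom_polys c m.
        (\<forall>y\<in>hom_polys c m. \<phi> (L * (L' * v * y)) + t * \<phi> (L * (M * v * y)) = 0) \<longrightarrow>
        (\<forall>y\<in>hom_polys c m. \<phi> (L * (L' * v * y)) = 0))"
    proof (rule mp.kernel_pencil[OF inf subspace_hom_polys])
      show "finite ((\<lambda>m. Poly_Mapping.single m (1::'k)) ` monoms c m)"
        by (simp add: finite_monoms)
      show "hom_polys c m \<subseteq> mp.span ((\<lambda>m. Poly_Mapping.single m 1) ` monoms c m)"
        by (simp add: hom_polys_eq_span)
      fix v y :: "'k mpol"
      assume v: "v \<in> hom_polys c m" and y: "y \<in> hom_polys c m"
        and 0: "\<And>y. y \<in> hom_polys c m \<Longrightarrow> \<phi> (L * (L' * v * y)) = 0"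
      have "v \<in> K L" by (rule in_K[OF v 0])
      then have "\<phi> (L * v * (M * y)) = 0" using mult_low[OF M y] by (simp add: K_def)
      then show "\<phi> (L * (M * v * y)) = 0" by (simp add: ac_simps)
    qed (simp_all add: distrib_left distrib_right P.add cscale_mult_left cscale_mult_right P.scale)
    then obtain t where t: "t \<noteq> 0" and pencil: "\<forall>v\<in>hom_polys c m.
        (\<forall>y\<in>hom_polys c m. \<phi> (L * (L' * v * y)) + t * \<phi> (L * (M * v * y)) = 0) \<longrightarrow>
        (\<forall>y\<in>hom_polys c m. \<phi> (L * (L' * v * y)) = 0)"
      by blast
    let ?N = "L' + cscale t M"
    have N_mult: "\<phi> (?N * v * w) = \<phi> (L' * v * w) + t * \<phi> (M * v * w)" for v w
      by (simp add: distrib_right P.add cscale_mult_left P.scale)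
    have "K ?N = K L"
    proof (rule K_eq)
      show "?N \<in> hom_polys c 1"
        by (intro mp.subspace_add mp.subspace_scale subspace_hom_polys L' M)
      show "K ?N \<subseteq> K L"
      proof
        fix v assume v: "v \<in> K ?N"
        then have vS: "v \<in> hom_polys c m" by (simp add: K_def)
        have "\<phi> (L * (L' * v * y)) + t * \<phi> (L * (M * v * y)) = 0" if y: "y \<in> hom_polys c m" for y
        proof -
          have "\<phi> (?N * v * (L * y)) = 0" using v mult_low[OF L y] by (simp add: K_def)
          then show ?thesis unfolding N_mult by (simp add: ac_simps)
        qed
        then show "v \<in> K L" using in_K[OF vS] pencil vS by blast
      qed
    qed
    \<comment> \<open>The two equations differ by \<open>t * \<phi> (M * p * q)\<close> with
      \<open>t \<noteq> 0\<close>.\<close>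
    then have "\<phi> (?N * p * q) = 0" "\<phi> (L' * p * q) = 0"
      using p q K_L' unfolding K_def by blast+
    then show ?thesis using t by (simp add: N_mult)
  qed
  show ?thesis
  proof (intro bexI[OF _ L] ballI impI)
    fix p q :: "'k mpol"
    assume p: "p \<in> hom_polys c m" and 0: "\<forall>q\<in>hom_polys c (m + 1). \<phi> (L * p * q) = 0"
      and q: "q \<in> hom_polys c (m + 2)"
    have pK: "p \<in> K L" using p 0 by (simp add: K_def)
    have "q \<in> hom_polys c (Suc (m + 1))" using q by simp
    then show "\<phi> (p * q) = 0"
    proof (induction rule: hom_polys_Suc_induct)
      case subspace
      show ?case by (rule P.subspace_kernel)
    next
      case (var j r)
      then show ?case
        using killed[OF var_in_hom_polys[OF var(1)] pK var(2)] by (simp add: ac_simps)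
    qed
  qed
qed

section \<open>The Weak Lefschetz Property for arbitrary presentations\<close>

context macaulay_dual
begin

lemma var_notin: "0 < e \<Longrightarrow> \<exists>j<n. mpol_var j \<notin> I"
  using var_mult_mem[of 1 0] one_in_hom_polys one_notin by auto

text \<open>The middle degree is 0 and A_0 is \<open>k\<close>, so injectivity there only asks for a
  linear form outside \<open>I\<close>.\<close>

lemma weak_lefschetz_socle_degree_le_2:
  assumes "e = 1 \<or> e = 2"
  shows "weak_lefschetz n I"
proof -
  obtain j where j: "j < n" "mpol_var j \<notin> I" using var_notin assms by auto
  show ?thesis
  proof (rule weak_lefschetzI[OF var_in_hom_polys[OF j(1)], of 0])
    fix p :: "'k mpol" assume p: "p \<in> hom_polys n 0" "mpol_var j * p \<in> I"
    then have "p \<in> mp.span {1}" by (simp add: hom_polys_eq_span monoms_0)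
    then obtain a where a: "p = cscale a 1" by (auto simp: mp.span_singleton)
    have "a = 0"
    proof (rule ccontr)
      assume "a \<noteq> 0"
      have "cscale a (mpol_var j) \<in> I" using p(2) by (simp add: a cscale_mult_right)
      then show False
        using mp.subspace_scale[OF subspace_ideal, of "cscale a (mpol_var j)" "inverse a"] \<open>a \<noteq> 0\<close> j(2)
        by simp
    qed
    then show "p \<in> I" using mp.subspace_0[OF subspace_ideal] by (simp add: a)
  qed (use assms in auto)
qed

text \<open>Substituting a basis of $A_1$ for the variables presents the algebra with as many
  variables as its codimension.\<close>

lemma weak_lefschetz_of_compressed:
  assumes inf: "infinite (UNIV :: 'k set)" and "0 < m" and em: "e = 2 * m + 1 \<or> e = 2 * m + 2"
    and wlp: "compressed_have_wlp TYPE('k) (codimension n I) (2 * m + 1)"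
  shows "weak_lefschetz n I"
proof -
  have "1 \<le> e" using em by auto
  obtain c :: nat and g x :: "nat \<Rightarrow> 'k mpol" where
    g: "\<And>j. j < c \<Longrightarrow> g j \<in> hom_polys n 1" and
    res: "\<And>v. v \<in> hom_polys n 1 \<Longrightarrow> v - (\<Sum>j<c. cscale (\<phi> (v * x j)) (g j)) \<in> I" and
    hvec: "hvec n I 1 = c"
  proof (rule dual_bases[OF \<open>1 \<le> e\<close>])
    fix d :: nat and g x :: "nat \<Rightarrow> 'k mpol"
    assume "\<And>j. j < d \<Longrightarrow> g j \<in> hom_polys n 1"
      "\<And>v. v \<in> hom_polys n 1 \<Longrightarrow> v - (\<Sum>j<d. cscale (\<phi> (v * x j)) (g j)) \<in> I" "hvec n I 1 = d"
    then show thesis by (rule that)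
  qed
  from hvec have c: "codimension n I = c" by (simp add: codimension_def)
  have "0 < c"
  proof (rule ccontr)
    assume "\<not> 0 < c"
    then have "v \<in> I" if "v \<in> hom_polys n 1" for v using res[OF that] by simp
    then show False using var_notin \<open>1 \<le> e\<close> var_in_hom_polys by auto
  qed
  define \<theta> where "\<theta> = subst mpol_const g"
  have \<theta>_deg: "\<theta> p \<in> hom_polys n i" if "p \<in> hom_polys c i" for p i
    unfolding \<theta>_def using that g by (rule subst_hom_polys)
  have \<theta>_add: "\<theta> (p + q) = \<theta> p + \<theta> q" and \<theta>_mult: "\<theta> (p * q) = \<theta> p * \<theta> q"
    and \<theta>_scale: "\<theta> (cscale a p) = cscale a (\<theta> p)" and \<theta>_0: "\<theta> 0 = 0" and \<theta>_1: "\<theta> 1 = 1"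
    and \<theta>_var: "\<theta> (mpol_var j) = g j" for p q a j
    by (simp_all add: \<theta>_def const_coeff.subst_add const_coeff.subst_mult const_coeff.subst_cscale
        cscale_def[symmetric] const_coeff.subst_1 const_coeff.subst_var)
  \<comment> \<open>Surjectivity of \<theta> onto the degree-\<open>i\<close> piece of the quotient.
    It is known in degree 1 by the choice of \<open>g\<close> and spreads upward because forms are
    sums of products with variables.\<close>
  define good where "good i p \<longleftrightarrow> (\<exists>r\<in>hom_polys c i. p - \<theta> r \<in> I)" for i p
  have good_subspace: "mp.subspace {p. good i p}" for i
  proof (rule mp.subspaceI; clarify)
    show "good i 0"
      unfolding good_def using mp.subspace_0[OF subspace_ideal]
      by (intro bexI[of _ 0]) (simp_all add: \<theta>_0)
    fix p q assume "good i p" "good i q"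
    then obtain r s where "r \<in> hom_polys c i" "p - \<theta> r \<in> I" "s \<in> hom_polys c i" "q - \<theta> s \<in> I"
      unfolding good_def by blast
    then show "good i (p + q)"
      unfolding good_def
      using mp.subspace_add[OF subspace_ideal, of "p - \<theta> r" "q - \<theta> s"]
        mp.subspace_add[OF subspace_hom_polys]
      by (intro bexI[of _ "r + s"]) (simp_all add: \<theta>_add algebra_simps)
  next
    fix a p assume "good i p"
    then obtain r where "r \<in> hom_polys c i" "p - \<theta> r \<in> I" unfolding good_def by blast
    then show "good i (cscale a p)"
      unfolding good_def
      using mp.subspace_scale[OF subspace_ideal, of "p - \<theta> r" a]
        mp.subspace_scale[OF subspace_hom_polys]
      by (intro bexI[of _ "cscale a r"]) (simp_all add: \<theta>_scale mp.scale_right_diff_distrib)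
  qed
  have good1: "good 1 v" if "v \<in> hom_polys n 1" for v
  proof -
    let ?r = "\<Sum>j<c. cscale (\<phi> (v * x j)) (mpol_var j)"
    have "\<theta> (\<Sum>j\<in>A. cscale (\<phi> (v * x j)) (mpol_var j)) = (\<Sum>j\<in>A. cscale (\<phi> (v * x j)) (g j))"
      if "finite A" for A
      using that by induction (simp_all add: \<theta>_add \<theta>_scale \<theta>_0 \<theta>_var)
    then have "v - \<theta> ?r \<in> I" using res[OF that] by simp
    moreover have "?r \<in> hom_polys c 1"
      using var_in_hom_polys by (intro mp.subspace_sum mp.subspace_scale subspace_hom_polys) auto
    ultimately show ?thesis unfolding good_def by blast
  qed
  have good: "good i p" if "p \<in> hom_polys n i" for i p
    using that
  proof (induction i arbitrary: p)
    case 0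
    then show ?case
    proof (induction rule: hom_polys_induct)
      case subspace
      show ?case by (rule good_subspace)
    next
      case (monom m)
      then show ?case
        using mp.subspace_0[OF subspace_ideal] one_in_hom_polys
        by (auto simp: good_def monoms_0 \<theta>_1 intro!: bexI[of _ 1])
    qed
  next
    case (Suc i)
    from Suc.prems show ?case
    proof (induction rule: hom_polys_Suc_induct)
      case subspace
      show ?case by (rule good_subspace)
    next
      case (var j q)
      obtain r where r: "r \<in> hom_polys c i" "q - \<theta> r \<in> I"
        using Suc.IH[OF var(2)] unfolding good_def by blast
      obtain l where l: "l \<in> hom_polys c 1" "mpol_var j - \<theta> l \<in> I"
        using good1[OF var_in_hom_polys[OF var(1)]] unfolding good_def by blast
      have "mpol_var j * q - \<theta> (l * r) = mpol_var j * (q - \<theta> r) + \<theta> r * (mpol_var j - \<theta> l)"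
        by (simp add: \<theta>_mult algebra_simps)
      also have "\<dots> \<in> I"
        by (intro mp.subspace_add subspace_ideal mult_mem r(2) l(2)
            hom_polys_carrier[OF var_in_hom_polys[OF var(1)]] hom_polys_carrier[OF \<theta>_deg[OF r(1)]])
      finally show ?case
        unfolding good_def using hom_polys_mult[OF l(1) r(1)] by auto
    qed
  qed
  \<comment> \<open>As \<theta> is surjective modulo \<open>I\<close>, the pulled-back functional
    belongs to the same algebra, now presented in \<open>c\<close> variables.\<close>
  have form: "form_functional c e (\<lambda>p. \<phi> (\<theta> p))"
    by unfold_locales (simp_all add: \<theta>_add \<theta>_scale add scale other_degree[OF \<theta>_deg])
  have "\<exists>L\<in>hom_polys c 1. \<forall>p\<in>hom_polys c m. (\<forall>q\<in>hom_polys c (e - (m + 1)). \<phi> (\<theta> (L * p * q)) = 0) \<longrightarrow>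
      (\<forall>q\<in>hom_polys c (e - m). \<phi> (\<theta> (p * q)) = 0)"
    using em
  proof
    assume e: "e = 2 * m + 1"
    then have deg: "e - (m + 1) = m" "e - m = m + 1" by simp_all
    show ?thesis
      unfolding deg
      by (rule injective_middle_odd[OF inf form[unfolded e] \<open>0 < m\<close> \<open>0 < c\<close> wlp[unfolded c]])
  next
    assume e: "e = 2 * m + 2"
    then have deg: "e - (m + 1) = m + 1" "e - m = m + 2" by simp_all
    show ?thesis
      unfolding deg
      by (rule injective_middle_even[OF inf form[unfolded e] \<open>0 < m\<close> \<open>0 < c\<close> wlp[unfolded c]])
  qed
  then obtain L where L: "L \<in> hom_polys c 1" and inj: "\<forall>p\<in>hom_polys c m.
      (\<forall>q\<in>hom_polys c (e - (m + 1)). \<phi> (\<theta> (L * p * q)) = 0) \<longrightarrow>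
      (\<forall>q\<in>hom_polys c (e - m). \<phi> (\<theta> (p * q)) = 0)"
    by blast
  have me: "m \<le> e" using em by auto
  show ?thesis
  proof (rule weak_lefschetzI[OF \<theta>_deg[OF L] em])
    fix p assume p: "p \<in> hom_polys n m" "\<theta> L * p \<in> I"
    \<comment> \<open>Membership in \<open>I\<close> is decided after replacing \<open>p\<close>,
      and later each test form, by the image of a form in \<open>c\<close> variables; the errors lie
      in \<open>I\<close> and are killed by \<phi>.\<close>
    obtain r where r: "r \<in> hom_polys c m" "p - \<theta> r \<in> I"
      using good[OF p(1)] unfolding good_def by blast
    have "\<theta> L * \<theta> r = \<theta> L * p - \<theta> L * (p - \<theta> r)" by (simp add: algebra_simps)
    also have "\<dots> \<in> I"
      by (intro mp.subspace_diff subspace_ideal p(2) mult_mem r(2) hom_polys_carrier[OF \<theta>_deg[OF L]])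
    finally have Lr: "\<theta> L * \<theta> r \<in> I" .
    have "\<forall>t\<in>hom_polys c (e - (m + 1)). \<phi> (\<theta> (L * r * t)) = 0"
      using vanish_mult[OF Lr hom_polys_carrier[OF \<theta>_deg]] by (simp add: \<theta>_mult)
    then have r_perp: "\<phi> (\<theta> (r * q)) = 0" if "q \<in> hom_polys c (e - m)" for q
      using inj r(1) that by blast
    have "\<theta> r \<in> I"
    proof (subst mem_iff[OF \<theta>_deg[OF r(1)] me], rule ballI)
      fix q :: "'k mpol" assume q: "q \<in> hom_polys n (e - m)"
      then obtain s where s: "s \<in> hom_polys c (e - m)" "q - \<theta> s \<in> I"
        using good unfolding good_def by blast
      have "\<theta> r * q = \<theta> (r * s) + (q - \<theta> s) * \<theta> r" by (simp add: \<theta>_mult algebra_simps)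
      then show "\<phi> (\<theta> r * q) = 0"
        using r_perp[OF s(1)] vanish_mult[OF s(2) hom_polys_carrier[OF \<theta>_deg[OF r(1)]]]
        by (simp add: add)
    qed
    then show "p \<in> I"
      using mp.subspace_add[OF subspace_ideal r(2)] by fastforce
  qed
qed

text \<open>Rules out socle degree 0 when the codimension is 3.\<close>

lemma codimension_socle_degree_0:
  assumes "e = 0"
  shows "codimension n I = 0"
proof -
  interpret A: ring "galg n I" by (rule ring_galg)
  have "graded_piece n I 1 = {\<zero>\<^bsub>galg n I\<^esub>}"
    unfolding graded_piece_zero_iff using above assms by auto
  then have "A.dimension 0 (ground_field n I) (graded_piece n I 1)"
    using A.dimension.intros(1) by simp
  then show ?thesis
    unfolding codimension_def by (rule hvec_eqI[OF one_notin])
qed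

end

theorem corollary2p5:
  shows
    "(\<forall>r e :: nat. 0 < r \<and> 0 < e \<and> even e \<longrightarrow>
        (\<forall>n (I :: 'k::alg_closed_field mpol set).
           compressed_gorenstein n I \<and> codimension n I \<le> r \<and> has_socle_degree n I (e - 1)
           \<longrightarrow> weak_lefschetz n I) \<longrightarrow>
        (\<forall>n (I :: 'k mpol set).
           artinian_gorenstein n I \<and> codimension n I \<le> r \<and> has_socle_degree n I e
           \<longrightarrow> weak_lefschetz n I))
     \<and>
     ((\<forall>n (I :: 'k mpol set) e.
           compressed_gorenstein n I \<and> codimension n I = 3 \<and> has_socle_degree n I e \<and> odd e
           \<longrightarrow> weak_lefschetz n I) \<longrightarrow>
      (\<forall>n (I :: 'k mpol set).
           artinian_gorenstein n I \<and> codimension n I = 3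
           \<longrightarrow> weak_lefschetz n I))"
proof (intro conjI allI impI; elim conjE)
  fix r e n :: nat and I :: "'k mpol set"
  assume hyp: "\<forall>n (I :: 'k mpol set).
      compressed_gorenstein n I \<and> codimension n I \<le> r \<and> has_socle_degree n I (e - 1)
        \<longrightarrow> weak_lefschetz n I"
    and "0 < e" "even e" and AG: "artinian_gorenstein n I"
    and r: "codimension n I \<le> r" and soc: "has_socle_degree n I e"
  obtain \<phi> where "macaulay_dual n e \<phi> I" using AG soc by (rule artinian_gorenstein_imp_dual)
  then interpret macaulay_dual n e \<phi> I .
  obtain m where m: "e = 2 * m + 2"
    using \<open>0 < e\<close> \<open>even e\<close> by (metis dvdE mult_Suc_right add.commute not0_implies_Suc mult_0_right neq0_conv)
  show "weak_lefschetz n I"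
  proof (cases "m = 0")
    case True
    then show ?thesis using m by (intro weak_lefschetz_socle_degree_le_2) auto
  next
    case False
    \<comment> \<open>Here \<open>e - 1 = 2 * m + 1\<close>, and the codimension of \<open>I\<close>
      is one of those up to \<open>r\<close> that the hypothesis covers.\<close>
    have "compressed_have_wlp TYPE('k) (codimension n I) (2 * m + 1)"
      unfolding compressed_have_wlp_def using hyp r m by simp
    then show ?thesis
      using weak_lefschetz_of_compressed[OF infinite_UNIV_alg_closed, of m] False m by simp
  qed
next
  \<comment> \<open>Not an instance of the first half: the hypothesis concerns codimension 3 alone,
    and odd socle degrees must be covered too. The reduction keeps the codimension and handles both
    parities, so it still applies.\<close>
  fix n :: nat and I :: "'k mpol set"
  assume hyp: "\<forall>n (I :: 'k mpol set) e.
      compressed_gorenstein n I \<and> codimension n I = 3 \<and> has_socle_degree n I e \<and> odd e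
        \<longrightarrow> weak_lefschetz n I"
    and AG: "artinian_gorenstein n I" and 3: "codimension n I = 3"
  obtain e where soc: "has_socle_degree n I e"
    using artinian_gorenstein_has_socle_degree[OF AG] by blast
  obtain \<phi> where "macaulay_dual n e \<phi> I" using AG soc by (rule artinian_gorenstein_imp_dual)
  then interpret macaulay_dual n e \<phi> I .
  have "e \<noteq> 0" using codimension_socle_degree_0 3 by auto
  \<comment> \<open>The middle degree for both parities; the subtraction does not truncate because
    \<open>e \<noteq> 0\<close>.\<close>
  define m where "m = (e - 1) div 2"
  have m: "e = 2 * m + 1 \<or> e = 2 * m + 2" using \<open>e \<noteq> 0\<close> unfolding m_def by presburger
  show "weak_lefschetz n I"
  proof (cases "m = 0")
    case True
    then show ?thesis using m by (intro weak_lefschetz_socle_degree_le_2) auto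
  next
    case False
    have odd_m: "odd (2 * m + 1)" by simp
    have "compressed_have_wlp TYPE('k) (codimension n I) (2 * m + 1)"
      unfolding compressed_have_wlp_def 3 using hyp odd_m by blast
    then show ?thesis
      using weak_lefschetz_of_compressed[OF infinite_UNIV_alg_closed, of m] False m by simp
  qed
qed

end
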